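(* Let $n$ be a positive integer, $\mathcal{M}$ an $n$-abelian category and $P\in\mathcal{M}$ a projective object. Then, for every morphism $f\colon L\to M$ in $\mathcal{M}$ and every weak cokernel $g\colon M\to N$ of $f$, the sequence of abelian groups $$\mathcal{M}(P,L)\xrightarrow{\ ?\cdot f\ }\mathcal{M}(P,M)\xrightarrow{\ ?\cdot g\ }\mathcal{M}(P,N)$$ is exact.
   Context: Composition is written left to right: for $f\colon A\to B$ and $g\colon B\to C$ the composite $A\to C$ is $fg$; thus $?\cdot f$ denotes the map $u\mapsto uf$. **Weak cokernel.** A weak cokernel of $f\colon A\to B$ in an additive category $\mathcal{C}$ is a morphism $g\colon B\to C$ such that for all $C'\in\mathcal{C}$ the sequence $\mathcal{C}(C,C')\to\mathcal{C}(B,C')\to\mathcal{C}(A,C')$ induced by $g$ and $f$ is exact. **Projective object.** $P\in\mathcal{C}$ is projective if for every epimorphism $f\colon A\to B$ in $\mathcal{C}$ the map $\mathcal{C}(P,A)\to\mathcal{C}(P,B)$, $u\mapsto uf$, is surjective. **$n$-cokernels, $n$-kernels, $n$-exact sequences.** In an additive category $\mathcal{C}$, an $n$-cokernel of $d^0\colon X^0\to X^1$ is a sequence $(d^1,\dots,d^n)$, $X^1\xrightarrow{d^1}X^2\to\cdots\xrightarrow{d^n}X^{n+1}$, such that for all $Y\in\mathcal{C}$ the induced sequence $0\to\mathcal{C}(X^{n+1},Y)\to\mathcal{C}(X^n,Y)\to\cdots\to\mathcal{C}(X^1,Y)\to\mathcal{C}(X^0,Y)$ is exact. Dually, an $n$-kernel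 of $d^n\colon X^n\to X^{n+1}$ is a sequence $(d^0,\dots,d^{n-1})$, $X^0\to\cdots\to X^n$, such that $0\to\mathcal{C}(Y,X^0)\to\cdots\to\mathcal{C}(Y,X^n)\to\mathcal{C}(Y,X^{n+1})$ is exact for all $Y$. An $n$-exact sequence is a complex $X^0\xrightarrow{d^0}X^1\to\cdots\to X^n\xrightarrow{d^n}X^{n+1}$ such that $(d^0,\dots,d^{n-1})$ is an $n$-kernel of $d^n$ and $(d^1,\dots,d^n)$ is an $n$-cokernel of $d^0$. **$n$-abelian category.** An additive category $\mathcal{M}$ such that: (A0) $\mathcal{M}$ is idempotent complete; (A1) every morphism in $\mathcal{M}$ has an $n$-kernel and an $n$-cokernel; (A2) for every monomorphism $f^0\colon X^0\to X^1$ in $\mathcal{M}$ and every $n$-cokernel $(f^1,\dots,f^n)$ of $f^0$, the sequence $(f^0,f^1,\dots,f^n)$ is $n$-exact; (A2$^{\mathrm{op}}$) for every epimorphism $g^n\colon X^n\to X^{n+1}$ in $\mathcal{M}$ and every $n$-kernel $(g^0,\dots,g^{n-1})$ of $g^n$, the sequence $(g^0,\dots,g^n)$ is $n$-exact. *)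

theory Defs
  imports "HOL-Algebra.Exact_Sequence"
begin

record ('o, 'm) category_str =
  Ob :: "'o set"
  Ar :: "'m set"
  Dom :: "'m \<Rightarrow> 'o"
  Cod :: "'m \<Rightarrow> 'o"
  Id :: "'o \<Rightarrow> 'm"
  Comp :: "'m \<Rightarrow> 'm \<Rightarrow> 'm" (infixl \<open>\<cdot>\<index>\<close> 70)

definition Mor :: "('o, 'm, 'x) category_str_scheme \<Rightarrow> 'o \<Rightarrow> 'o \<Rightarrow> 'm set"
  where "Mor C A B = {f \<in> Ar C. Dom C f = A \<and> Cod C f = B}"

text \<open>Composition is written left to right: for \<open>f : A \<rightarrow> B\<close> and \<open>g : B \<rightarrow> D\<close>, the composite
  \<open>A \<rightarrow> D\<close> is \<open>f \<cdot> g\<close>. Nothing is assumed about \<open>f \<cdot> g\<close> if \<open>f\<close> and \<open>g\<close> are not composable.\<close>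

locale category =
  fixes C (structure)
  assumes Dom_Ob: "f \<in> Ar C \<Longrightarrow> Dom C f \<in> Ob C"
    and Cod_Ob: "f \<in> Ar C \<Longrightarrow> Cod C f \<in> Ob C"
    and Id_Mor: "A \<in> Ob C \<Longrightarrow> Id C A \<in> Mor C A A"
    and Comp_Mor: "\<lbrakk>f \<in> Mor C A B; g \<in> Mor C B D\<rbrakk> \<Longrightarrow> f \<cdot> g \<in> Mor C A D"
    and Id_left: "f \<in> Mor C A B \<Longrightarrow> Id C A \<cdot> f = f"
    and Id_right: "f \<in> Mor C A B \<Longrightarrow> f \<cdot> Id C B = f"
    and Comp_assoc: "\<lbrakk>f \<in> Mor C A B; g \<in> Mor C B D; h \<in> Mor C D E\<rbrakk>
          \<Longrightarrow> (f \<cdot> g) \<cdot> h = f \<cdot> (g \<cdot> h)"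

definition monomorphism :: "('o, 'm, 'x) category_str_scheme \<Rightarrow> 'm \<Rightarrow> bool"
  where "monomorphism C f \<longleftrightarrow> f \<in> Ar C \<and>
    (\<forall>A \<in> Ob C. \<forall>u \<in> Mor C A (Dom C f). \<forall>v \<in> Mor C A (Dom C f).
       u \<cdot>\<^bsub>C\<^esub> f = v \<cdot>\<^bsub>C\<^esub> f \<longrightarrow> u = v)"

definition epimorphism :: "('o, 'm, 'x) category_str_scheme \<Rightarrow> 'm \<Rightarrow> bool"
  where "epimorphism C f \<longleftrightarrow> f \<in> Ar C \<and>
    (\<forall>A \<in> Ob C. \<forall>u \<in> Mor C (Cod C f) A. \<forall>v \<in> Mor C (Cod C f) A.
       f \<cdot>\<^bsub>C\<^esub> u = f \<cdot>\<^bsub>C\<^esub> v \<longrightarrow> u = v)"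

definition projective_object :: "('o, 'm, 'x) category_str_scheme \<Rightarrow> 'o \<Rightarrow> bool"
  where "projective_object C P \<longleftrightarrow> P \<in> Ob C \<and>
    (\<forall>A \<in> Ob C. \<forall>B \<in> Ob C. \<forall>f \<in> Mor C A B. epimorphism C f \<longrightarrow>
       (\<lambda>u. u \<cdot>\<^bsub>C\<^esub> f) ` Mor C P A = Mor C P B)"

definition idempotent_complete :: "('o, 'm, 'x) category_str_scheme \<Rightarrow> bool"
  where "idempotent_complete C \<longleftrightarrow>
    (\<forall>A \<in> Ob C. \<forall>e \<in> Mor C A A. e \<cdot>\<^bsub>C\<^esub> e = e \<longrightarrow>
       (\<exists>B \<in> Ob C. \<exists>r \<in> Mor C A B. \<exists>s \<in> Mor C B A.
          r \<cdot>\<^bsub>C\<^esub> s = e \<and> s \<cdot>\<^bsub>C\<^esub> r = Id C B))"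

record ('o, 'm) additive_str = "('o, 'm) category_str" +
  Add :: "'m \<Rightarrow> 'm \<Rightarrow> 'm" (infixl \<open>\<boxplus>\<index>\<close> 65)
  Zero :: "'o \<Rightarrow> 'o \<Rightarrow> 'm"

text \<open>The abelian group of morphisms from \<open>A\<close> to \<open>B\<close>, as a record of type \<open>monoid\<close>, so that
  the predicate \<open>exact_seq\<close> of HOL-Algebra applies to it.\<close>

definition Mor_group :: "('o, 'm, 'x) additive_str_scheme \<Rightarrow> 'o \<Rightarrow> 'o \<Rightarrow> 'm monoid"
  where "Mor_group C A B = \<lparr>carrier = Mor C A B, monoid.mult = Add C, one = Zero C A B\<rparr>"

definition biproduct ::
  "('o, 'm, 'x) additive_str_scheme \<Rightarrow> 'o \<Rightarrow> 'o \<Rightarrow> 'o \<Rightarrow> 'm \<Rightarrow> 'm \<Rightarrow> 'm \<Rightarrow> 'm \<Rightarrow> bool"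
  where "biproduct C A B S i j p q \<longleftrightarrow> S \<in> Ob C \<and>
    i \<in> Mor C A S \<and> j \<in> Mor C B S \<and> p \<in> Mor C S A \<and> q \<in> Mor C S B \<and>
    i \<cdot>\<^bsub>C\<^esub> p = Id C A \<and> j \<cdot>\<^bsub>C\<^esub> q = Id C B \<and>
    i \<cdot>\<^bsub>C\<^esub> q = Zero C A B \<and> j \<cdot>\<^bsub>C\<^esub> p = Zero C B A \<and>
    p \<cdot>\<^bsub>C\<^esub> i \<boxplus>\<^bsub>C\<^esub> q \<cdot>\<^bsub>C\<^esub> j = Id C S"

definition zero_object :: "('o, 'm, 'x) category_str_scheme \<Rightarrow> 'o \<Rightarrow> bool"
  where "zero_object C Z \<longleftrightarrow> Z \<in> Ob C \<and>
    (\<forall>A \<in> Ob C. (\<exists>!f. f \<in> Mor C Z A) \<and> (\<exists>!f. f \<in> Mor C A Z))"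

locale additive_category = category C for C (structure) +
  assumes Mor_group: "\<lbrakk>A \<in> Ob C; B \<in> Ob C\<rbrakk> \<Longrightarrow> comm_group (Mor_group C A B)"
    and Comp_Add: "\<lbrakk>f \<in> Mor C A B; g \<in> Mor C B D; h \<in> Mor C B D\<rbrakk>
          \<Longrightarrow> f \<cdot> (g \<boxplus> h) = f \<cdot> g \<boxplus> f \<cdot> h"
    and Add_Comp: "\<lbrakk>f \<in> Mor C A B; g \<in> Mor C A B; h \<in> Mor C B D\<rbrakk>
          \<Longrightarrow> (f \<boxplus> g) \<cdot> h = f \<cdot> h \<boxplus> g \<cdot> h"
    and ex_zero_object: "\<exists>Z. zero_object C Z"
    and ex_biproduct: "\<lbrakk>A \<in> Ob C; B \<in> Ob C\<rbrakk> \<Longrightarrow> \<exists>S i j p q. biproduct C A B S i j p q"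

text \<open>Pitfall: \<open>exact_seq\<close> lists the groups and the homomorphisms from right to left, that is,
  \<open>G\<^sub>1 \<rightarrow> G\<^sub>2 \<rightarrow> G\<^sub>3\<close> with maps \<open>a\<close>, \<open>b\<close> is \<open>exact_seq ([G\<^sub>3, G\<^sub>2, G\<^sub>1], [b, a])\<close>.\<close>

definition weak_cokernel :: "('o, 'm, 'x) additive_str_scheme \<Rightarrow> 'm \<Rightarrow> 'm \<Rightarrow> bool"
  where "weak_cokernel C f g \<longleftrightarrow> f \<in> Ar C \<and> g \<in> Ar C \<and> Cod C f = Dom C g \<and>
    (\<forall>Y \<in> Ob C. exact_seq
      ([Mor_group C (Dom C f) Y, Mor_group C (Dom C g) Y, Mor_group C (Cod C g) Y],
       [\<lambda>u. f \<cdot>\<^bsub>C\<^esub> u, \<lambda>u. g \<cdot>\<^bsub>C\<^esub> u]))"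

text \<open>A diagram \<open>X\<^sup>0 \<rightarrow> X\<^sup>1 \<rightarrow> \<dots> \<rightarrow> X\<^sup>k\<close> with \<open>k > 0\<close> is given by the list \<open>[d\<^sup>0, \<dots>, d\<^sup>k\<^sup>-\<^sup>1]\<close> of its
  morphisms; \<open>path_obs\<close> is then \<open>[X\<^sup>0, \<dots>, X\<^sup>k]\<close>.\<close>

definition path :: "('o, 'm, 'x) category_str_scheme \<Rightarrow> 'm list \<Rightarrow> bool"
  where "path C ds \<longleftrightarrow> ds \<noteq> [] \<and> set ds \<subseteq> Ar C \<and>
    (\<forall>i. Suc i < length ds \<longrightarrow> Cod C (ds ! i) = Dom C (ds ! Suc i))"

definition path_obs :: "('o, 'm, 'x) category_str_scheme \<Rightarrow> 'm list \<Rightarrow> 'o list"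
  where "path_obs C ds = Dom C (hd ds) # map (Cod C) ds"

definition is_complex :: "('o, 'm, 'x) additive_str_scheme \<Rightarrow> 'm list \<Rightarrow> bool"
  where "is_complex C ds \<longleftrightarrow> path C ds \<and>
    (\<forall>i. Suc i < length ds \<longrightarrow>
       ds ! i \<cdot>\<^bsub>C\<^esub> ds ! Suc i = Zero C (Dom C (ds ! i)) (Cod C (ds ! Suc i)))"

text \<open>The next two definitions express exactness of
  \<open>0 \<rightarrow> C(X\<^sup>k, Y) \<rightarrow> \<dots> \<rightarrow> C(X\<^sup>1, Y) \<rightarrow> C(X\<^sup>0, Y)\<close> and of
  \<open>0 \<rightarrow> C(Y, X\<^sup>0) \<rightarrow> C(Y, X\<^sup>1) \<rightarrow> \<dots> \<rightarrow> C(Y, X\<^sup>k)\<close>, respectively. The leading \<open>0\<close> is the trivial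
  subgroup of its successor, with the inclusion as the map. By the convention of \<open>exact_seq\<close>,
  the contravariant sequence is listed in the order of the diagram, the covariant one in
  reverse order.\<close>

definition contra_left_exact :: "('o, 'm, 'x) additive_str_scheme \<Rightarrow> 'm list \<Rightarrow> 'o \<Rightarrow> bool"
  where "contra_left_exact C ds Y \<longleftrightarrow> exact_seq
    (map (\<lambda>X. Mor_group C X Y) (path_obs C ds) @ [singleton_group (Zero C (Cod C (last ds)) Y)],
     map (\<lambda>d u. d \<cdot>\<^bsub>C\<^esub> u) ds @ [\<lambda>u. u])"

definition co_left_exact :: "('o, 'm, 'x) additive_str_scheme \<Rightarrow> 'm list \<Rightarrow> 'o \<Rightarrow> bool"
  where "co_left_exact C ds Y \<longleftrightarrow> exact_seq
    (map (\<lambda>X. Mor_group C Y X) (rev (path_obs C ds)) @ [singleton_group (Zero C Y (Dom C (hd ds)))],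
     map (\<lambda>d u. u \<cdot>\<^bsub>C\<^esub> d) (rev ds) @ [\<lambda>u. u])"

definition n_cokernel :: "nat \<Rightarrow> ('o, 'm, 'x) additive_str_scheme \<Rightarrow> 'm \<Rightarrow> 'm list \<Rightarrow> bool"
  where "n_cokernel n C f ds \<longleftrightarrow> length ds = n \<and> path C (f # ds) \<and>
    (\<forall>Y \<in> Ob C. contra_left_exact C (f # ds) Y)"

definition n_kernel :: "nat \<Rightarrow> ('o, 'm, 'x) additive_str_scheme \<Rightarrow> 'm \<Rightarrow> 'm list \<Rightarrow> bool"
  where "n_kernel n C g ds \<longleftrightarrow> length ds = n \<and> path C (ds @ [g]) \<and>
    (\<forall>Y \<in> Ob C. co_left_exact C (ds @ [g]) Y)"

definition n_exact :: "nat \<Rightarrow> ('o, 'm, 'x) additive_str_scheme \<Rightarrow> 'm list \<Rightarrow> bool"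
  where "n_exact n C ds \<longleftrightarrow> length ds = Suc n \<and> is_complex C ds \<and>
    n_kernel n C (last ds) (butlast ds) \<and> n_cokernel n C (hd ds) (tl ds)"

locale n_abelian_category = additive_category C for n :: nat and C (structure) +
  assumes A0: "idempotent_complete C"
    and A1_kernel: "f \<in> Ar C \<Longrightarrow> \<exists>ds. n_kernel n C f ds"
    and A1_cokernel: "f \<in> Ar C \<Longrightarrow> \<exists>ds. n_cokernel n C f ds"
    and A2: "\<lbrakk>monomorphism C f; n_cokernel n C f ds\<rbrakk> \<Longrightarrow> n_exact n C (f # ds)"
    and A2_op: "\<lbrakk>epimorphism C g; n_kernel n C g ds\<rbrakk> \<Longrightarrow> n_exact n C (ds @ [g])"

end

theory Submission
  imports Defs
begin

text \<open>It is enough to treat the first morphism \<open>g\<close> of an \<open>n\<close>-cokernel of \<open>f\<close>, because all weak cokernels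
  of \<open>f\<close> kill the same morphisms. Let \<open>k : K \<rightarrow> M\<close> be a weak kernel of \<open>g\<close> and \<open>k' : K' \<rightarrow> K\<close> a weak kernel
  of \<open>k\<close>, and write \<open>f = f\<^sub>1 \<cdot> k\<close>. A morphism \<open>h : P \<rightarrow> M\<close> with \<open>h \<cdot> g = 0\<close> factors as \<open>h = h\<^sub>1 \<cdot> k\<close>. If the
  morphism \<open>L \<oplus> K' \<rightarrow> K\<close> with components \<open>f\<^sub>1\<close> and \<open>k'\<close> is an epimorphism, then \<open>h\<^sub>1\<close> lifts along it, and
  composing with \<open>k\<close> exhibits \<open>h\<close> as a multiple of \<open>f\<close>.

  So let \<open>u : K \<rightarrow> W\<close> be killed by \<open>f\<^sub>1\<close> and \<open>k'\<close>. If \<open>u\<close> extends along \<open>k\<close>, possibly only after composing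
  with a monomorphism \<open>W \<rightarrow> W'\<close>, then the extension \<open>M \<rightarrow> W'\<close> is killed by \<open>f\<close>, hence factors through
  \<open>g\<close>, and \<open>u = 0\<close> (\<open>image_factor_Zero\<close>). What is needed is therefore exactness of the contravariant
  sequence of \<open>K' \<rightarrow> K \<rightarrow> M\<close> up to monomorphisms. More generally, one asks for this at the places
  \<open>0, 1, 2, \<dots>\<close> of the chain of successive weak kernels of a morphism \<open>d\<close>.

  If \<open>d\<close> is an epimorphism, the places \<open>0, \<dots>, n\<close> are exact: by \<open>A2_op\<close> an \<open>n\<close>-kernel of \<open>d\<close> is part of
  an \<open>n\<close>-exact sequence, and at the far end one forms the pushout of a monomorphism, which is again a
  monomorphism by \<open>A2\<close> (\<open>epimorphism_exact_up_to_mono\<close>). Now let \<open>g\<close> be a weak cokernel of \<open>d : X \<rightarrow> Y\<close>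
  for which the places up to some number, at least \<open>1\<close>, are exact. Then the argument above gives an
  epimorphism \<open>X \<oplus> K' \<rightarrow> K\<close>, with \<open>K' \<rightarrow> K \<rightarrow> Y\<close> the first weak kernels of \<open>g\<close>. Its chain of weak kernels
  is the mapping cone of a map from the chain of \<open>d\<close> to that of \<open>g\<close>. Exactness of the cone and of \<open>g\<close>
  gives that of \<open>d\<close> from place \<open>1\<close> on, with one place lost at the end (\<open>exact_up_to_mono_step\<close>).
  From the final epimorphism of an \<open>n\<close>-cokernel there are \<open>n - 1\<close> such steps down to its first
  morphism, which leaves the place \<open>1\<close> that is needed.\<close>

section \<open>Arithmetic of morphisms\<close>

context category
begin

text \<open>Stating the laws for \<open>Dom\<close> and \<open>Cod\<close> instead of for hom-sets leaves no middle object to be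
  guessed, so that the simplifier composes and reassociates on its own.\<close>

lemma Comp_Ar [simp]:
  assumes "f \<in> Ar C" "g \<in> Ar C" "Cod C f = Dom C g"
  shows "f \<cdot> g \<in> Ar C" "Dom C (f \<cdot> g) = Dom C f" "Cod C (f \<cdot> g) = Cod C g"
  using Comp_Mor[of f "Dom C f" "Cod C f" g "Cod C g"] assms by (auto simp: Mor_def)

lemma Comp_assoc_Ar [simp]:
  assumes "f \<in> Ar C" "g \<in> Ar C" "h \<in> Ar C" "Cod C f = Dom C g" "Cod C g = Dom C h"
  shows "(f \<cdot> g) \<cdot> h = f \<cdot> (g \<cdot> h)"
  using Comp_assoc[of f "Dom C f" "Cod C f" g "Cod C g" h "Cod C h"] assms by (auto simp: Mor_def)

text \<open>Composites are normalised to the right, where an equation \<open>f \<cdot> g = h\<close> no longer matches; this is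
  its form with a further factor.\<close>

lemma Comp_reassoc:
  assumes "f \<cdot> g = h" "f \<in> Ar C" "g \<in> Ar C" "x \<in> Ar C" "Cod C f = Dom C g" "Cod C g = Dom C x"
  shows "f \<cdot> (g \<cdot> x) = h \<cdot> x"
  using assms Comp_assoc_Ar by metis

lemma Id_Ar [simp]:
  assumes "A \<in> Ob C"
  shows "Id C A \<in> Ar C" "Dom C (Id C A) = A" "Cod C (Id C A) = A"
  using Id_Mor[OF assms] by (auto simp: Mor_def)

lemma Id_Comp [simp]: "f \<in> Ar C \<Longrightarrow> Dom C f = A \<Longrightarrow> Id C A \<cdot> f = f"
  using Id_left[of f A "Cod C f"] by (simp add: Mor_def)

lemma Comp_Id [simp]: "f \<in> Ar C \<Longrightarrow> Cod C f = A \<Longrightarrow> f \<cdot> Id C A = f"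
  using Id_right[of f "Dom C f" A] by (simp add: Mor_def)

lemmas [simp] = Dom_Ob Cod_Ob

lemma monomorphism_Comp:
  assumes "monomorphism C v" "monomorphism C w" "Cod C v = Dom C w"
  shows "monomorphism C (v \<cdot> w)"
proof -
  have A: "v \<in> Ar C" "w \<in> Ar C" using assms by (auto simp: monomorphism_def)
  have "x = y" if "X \<in> Ob C" "x \<in> Mor C X (Dom C v)" "y \<in> Mor C X (Dom C v)"
    "x \<cdot> (v \<cdot> w) = y \<cdot> (v \<cdot> w)" for X x y
  proof -
    have "(x \<cdot> v) \<cdot> w = (y \<cdot> v) \<cdot> w"
      using that A assms(3) by (auto simp: Mor_def)
    then have "x \<cdot> v = y \<cdot> v"
      using that A assms(2,3) unfolding monomorphism_def by (auto simp: Mor_def)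
    then show ?thesis using that assms(1) unfolding monomorphism_def by blast
  qed
  then show ?thesis using A assms(3) by (auto simp: monomorphism_def)
qed

lemma monomorphism_Id: "A \<in> Ob C \<Longrightarrow> monomorphism C (Id C A)"
  by (auto simp: monomorphism_def Mor_def)

end

context additive_category
begin

lemma Zero_Ar [simp]:
  assumes "A \<in> Ob C" "B \<in> Ob C"
  shows "Zero C A B \<in> Ar C" "Dom C (Zero C A B) = A" "Cod C (Zero C A B) = B"
proof -
  interpret G: comm_group "Mor_group C A B" using Mor_group[OF assms] .
  have "Zero C A B \<in> Mor C A B" using G.one_closed by (simp add: Mor_group_def)
  then show "Zero C A B \<in> Ar C" "Dom C (Zero C A B) = A" "Cod C (Zero C A B) = B"
    by (auto simp: Mor_def)
qed

definition Neg :: "'b \<Rightarrow> 'b" (\<open>\<boxminus>_\<close> [81] 80)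
  where "Neg f = inv\<^bsub>Mor_group C (Dom C f) (Cod C f)\<^esub> f"

lemma Add_Ar [simp]:
  assumes "f \<in> Ar C" "g \<in> Ar C" "Dom C f = Dom C g" "Cod C f = Cod C g"
  shows "f \<boxplus> g \<in> Ar C" "Dom C (f \<boxplus> g) = Dom C g" "Cod C (f \<boxplus> g) = Cod C g"
proof -
  interpret G: comm_group "Mor_group C (Dom C g) (Cod C g)" using Mor_group assms by simp
  have "f \<boxplus> g \<in> Mor C (Dom C g) (Cod C g)"
    using G.m_closed[of f g] assms by (simp add: Mor_group_def Mor_def)
  then show "f \<boxplus> g \<in> Ar C" "Dom C (f \<boxplus> g) = Dom C g" "Cod C (f \<boxplus> g) = Cod C g"
    by (auto simp: Mor_def)
qed

lemma Neg_Ar [simp]: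
  assumes "f \<in> Ar C"
  shows "\<boxminus> f \<in> Ar C" "Dom C (\<boxminus> f) = Dom C f" "Cod C (\<boxminus> f) = Cod C f"
proof -
  interpret G: comm_group "Mor_group C (Dom C f) (Cod C f)" using Mor_group assms by simp
  have "\<boxminus> f \<in> Mor C (Dom C f) (Cod C f)"
    using G.inv_closed[of f] assms by (simp add: Mor_group_def Mor_def Neg_def)
  then show "\<boxminus> f \<in> Ar C" "Dom C (\<boxminus> f) = Dom C f" "Cod C (\<boxminus> f) = Cod C f"
    by (auto simp: Mor_def)
qed

lemma Add_Neg [simp]:
  assumes "f \<in> Ar C"
  shows "f \<boxplus> \<boxminus> f = Zero C (Dom C f) (Cod C f)" "\<boxminus> f \<boxplus> f = Zero C (Dom C f) (Cod C f)"
proof -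
  interpret G: comm_group "Mor_group C (Dom C f) (Cod C f)" using Mor_group assms by simp
  show "f \<boxplus> \<boxminus> f = Zero C (Dom C f) (Cod C f)" "\<boxminus> f \<boxplus> f = Zero C (Dom C f) (Cod C f)"
    using G.r_inv[of f] G.l_inv[of f] assms by (simp_all add: Mor_group_def Mor_def Neg_def)
qed

lemma Add_assoc [simp]:
  assumes "f \<in> Ar C" "g \<in> Ar C" "h \<in> Ar C"
    "Dom C f = Dom C g" "Cod C f = Cod C g" "Dom C g = Dom C h" "Cod C g = Cod C h"
  shows "(f \<boxplus> g) \<boxplus> h = f \<boxplus> (g \<boxplus> h)"
proof -
  interpret G: comm_group "Mor_group C (Dom C g) (Cod C g)" using Mor_group assms by simp
  show ?thesis using G.m_assoc[of f g h] assms by (simp add: Mor_group_def Mor_def)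
qed

lemma Add_commute:
  assumes "f \<in> Ar C" "g \<in> Ar C" "Dom C f = Dom C g" "Cod C f = Cod C g"
  shows "f \<boxplus> g = g \<boxplus> f"
proof -
  interpret G: comm_group "Mor_group C (Dom C g) (Cod C g)" using Mor_group assms by simp
  show ?thesis using G.m_comm[of f g] assms by (simp add: Mor_group_def Mor_def)
qed

lemma Add_Zero [simp]:
  assumes "f \<in> Ar C" "Dom C f = A" "Cod C f = B"
  shows "f \<boxplus> Zero C A B = f" "Zero C A B \<boxplus> f = f"
proof -
  interpret G: comm_group "Mor_group C A B" using Mor_group assms by auto
  show "f \<boxplus> Zero C A B = f" "Zero C A B \<boxplus> f = f"
    using G.r_one[of f] G.l_one[of f] assms by (simp_all add: Mor_group_def Mor_def)
qed

lemma Add_Comp_Ar [simp]: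
  assumes "f \<in> Ar C" "g \<in> Ar C" "h \<in> Ar C"
    "Dom C f = Dom C g" "Cod C f = Dom C h" "Cod C g = Dom C h"
  shows "(f \<boxplus> g) \<cdot> h = f \<cdot> h \<boxplus> g \<cdot> h"
  using Add_Comp[of f "Dom C f" "Cod C f" g h "Cod C h"] assms by (simp add: Mor_def)

lemma Comp_Add_Ar [simp]:
  assumes "f \<in> Ar C" "g \<in> Ar C" "h \<in> Ar C"
    "Cod C f = Dom C g" "Cod C f = Dom C h" "Cod C g = Cod C h"
  shows "f \<cdot> (g \<boxplus> h) = f \<cdot> g \<boxplus> f \<cdot> h"
  using Comp_Add[of f "Dom C f" "Cod C f" g "Cod C g" h] assms by (simp add: Mor_def)

lemma Neg_unique:
  assumes "f \<in> Ar C" "g \<in> Ar C" "Dom C f = Dom C g" "Cod C f = Cod C g"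
    and "f \<boxplus> g = Zero C (Dom C f) (Cod C f)"
  shows "g = \<boxminus> f"
proof -
  have "g = (\<boxminus> f \<boxplus> f) \<boxplus> g" using assms by simp
  also have "\<dots> = \<boxminus> f \<boxplus> (f \<boxplus> g)" using assms(1-4) by (simp del: Add_Neg)
  also have "\<dots> = \<boxminus> f" unfolding assms(5) using assms(1-4) by simp
  finally show ?thesis .
qed

lemma Zero_Comp [simp]:
  assumes "f \<in> Ar C" "A \<in> Ob C" "Dom C f = B"
  shows "Zero C A B \<cdot> f = Zero C A (Cod C f)"
proof -
  let ?z = "Zero C A B \<cdot> f"
  have B: "B \<in> Ob C" using assms by auto
  have z: "?z \<in> Ar C" "Dom C ?z = A" "Cod C ?z = Cod C f" using assms B by auto
  have "?z \<boxplus> ?z = ?z"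
    using assms B Add_Comp_Ar[of "Zero C A B" "Zero C A B" f] by simp
  then have "?z \<boxplus> ?z \<boxplus> \<boxminus> ?z = ?z \<boxplus> \<boxminus> ?z" by simp
  then show ?thesis using z by simp
qed

lemma Comp_Zero [simp]:
  assumes "f \<in> Ar C" "B \<in> Ob C" "Cod C f = A"
  shows "f \<cdot> Zero C A B = Zero C (Dom C f) B"
proof -
  let ?z = "f \<cdot> Zero C A B"
  have A: "A \<in> Ob C" using assms by auto
  have z: "?z \<in> Ar C" "Dom C ?z = Dom C f" "Cod C ?z = B" using assms A by auto
  have "?z \<boxplus> ?z = ?z"
    using assms A Comp_Add_Ar[of f "Zero C A B" "Zero C A B"] by simp
  then have "?z \<boxplus> ?z \<boxplus> \<boxminus> ?z = ?z \<boxplus> \<boxminus> ?z" by simp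
  then show ?thesis using z by simp
qed

lemma Neg_Comp [simp]:
  assumes "f \<in> Ar C" "g \<in> Ar C" "Cod C f = Dom C g"
  shows "\<boxminus> f \<cdot> g = \<boxminus> (f \<cdot> g)"
  using Neg_unique[of "f \<cdot> g" "\<boxminus> f \<cdot> g"] Add_Comp_Ar[of f "\<boxminus> f" g] assms by simp

lemma Comp_Neg [simp]:
  assumes "f \<in> Ar C" "g \<in> Ar C" "Cod C f = Dom C g"
  shows "f \<cdot> \<boxminus> g = \<boxminus> (f \<cdot> g)"
  using Neg_unique[of "f \<cdot> g" "f \<cdot> \<boxminus> g"] Comp_Add_Ar[of f g "\<boxminus> g"] assms by simp

lemma Neg_Neg [simp]: "f \<in> Ar C \<Longrightarrow> \<boxminus> (\<boxminus> f) = f"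
  using Neg_unique[of "\<boxminus> f" f] by simp

lemma Neg_Zero [simp]: "A \<in> Ob C \<Longrightarrow> B \<in> Ob C \<Longrightarrow> \<boxminus> (Zero C A B) = Zero C A B"
  using Neg_unique[of "Zero C A B" "Zero C A B"] by simp

lemma Sub_eq_Zero:
  assumes "f \<in> Ar C" "g \<in> Ar C" "Dom C f = Dom C g" "Cod C f = Cod C g"
    and "f \<boxplus> \<boxminus> g = Zero C (Dom C g) (Cod C g)"
  shows "f = g"
  using Neg_unique[of "\<boxminus> g" f] Add_commute[of f "\<boxminus> g"] assms by simp

lemma Add_Neg_cancel [simp]:
  assumes "f \<in> Ar C" "g \<in> Ar C" "Dom C f = Dom C g" "Cod C f = Cod C g"
  shows "f \<boxplus> (\<boxminus> f \<boxplus> g) = g" "\<boxminus> f \<boxplus> (f \<boxplus> g) = g"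
  using Add_assoc[of f "\<boxminus> f" g] Add_assoc[of "\<boxminus> f" f g] assms by simp_all

lemma Neg_Add [simp]:
  assumes "f \<in> Ar C" "g \<in> Ar C" "Dom C f = Dom C g" "Cod C f = Cod C g"
  shows "\<boxminus> (f \<boxplus> g) = \<boxminus> f \<boxplus> \<boxminus> g"
proof (rule Neg_unique[symmetric])
  have "f \<boxplus> g \<boxplus> (\<boxminus> f \<boxplus> \<boxminus> g) = g \<boxplus> f \<boxplus> (\<boxminus> f \<boxplus> \<boxminus> g)"
    using assms Add_commute[of f g] by simp
  then show "f \<boxplus> g \<boxplus> (\<boxminus> f \<boxplus> \<boxminus> g) = Zero C (Dom C (f \<boxplus> g)) (Cod C (f \<boxplus> g))"
    using assms by simp
qed (use assms in auto)

lemma Add_left_commute: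
  assumes "f \<in> Ar C" "g \<in> Ar C" "h \<in> Ar C"
    "Dom C f = Dom C g" "Cod C f = Cod C g" "Dom C g = Dom C h" "Cod C g = Cod C h"
  shows "f \<boxplus> (g \<boxplus> h) = g \<boxplus> (f \<boxplus> h)"
  using Add_assoc[of f g h] Add_assoc[of g f h] Add_commute[of f g] assms by simp

lemma monomorphism_cancel_Zero:
  assumes "monomorphism C w" "x \<in> Ar C" "Cod C x = Dom C w" "x \<cdot> w = Zero C (Dom C x) (Cod C w)"
  shows "x = Zero C (Dom C x) (Cod C x)"
proof -
  have w: "w \<in> Ar C" using assms by (simp add: monomorphism_def)
  have "Zero C (Dom C x) (Dom C w) \<cdot> w = x \<cdot> w" using w assms by simp
  moreover have "x \<in> Mor C (Dom C x) (Dom C w)" "Zero C (Dom C x) (Dom C w) \<in> Mor C (Dom C x) (Dom C w)"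
    using w assms by (simp_all add: Mor_def)
  moreover have "Dom C x \<in> Ob C" using assms by simp
  ultimately show ?thesis
    using assms(1,3) unfolding monomorphism_def by metis
qed

lemma monomorphism_I:
  assumes "w \<in> Ar C"
    and "\<And>x. x \<in> Ar C \<Longrightarrow> Cod C x = Dom C w \<Longrightarrow> x \<cdot> w = Zero C (Dom C x) (Cod C w)
          \<Longrightarrow> x = Zero C (Dom C x) (Dom C w)"
  shows "monomorphism C w"
  unfolding monomorphism_def
proof (intro conjI ballI impI)
  fix A u v assume A: "A \<in> Ob C" "u \<in> Mor C A (Dom C w)" "v \<in> Mor C A (Dom C w)" "u \<cdot> w = v \<cdot> w"
  then have "u \<boxplus> \<boxminus> v = Zero C (Dom C v) (Cod C v)"
    using assms(1) assms(2)[of "u \<boxplus> \<boxminus> v"] by (simp add: Mor_def)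
  then show "u = v" using A Sub_eq_Zero by (simp add: Mor_def)
qed fact

lemma epimorphism_I:
  assumes "w \<in> Ar C"
    and "\<And>x. x \<in> Ar C \<Longrightarrow> Dom C x = Cod C w \<Longrightarrow> w \<cdot> x = Zero C (Dom C w) (Cod C x)
          \<Longrightarrow> x = Zero C (Cod C w) (Cod C x)"
  shows "epimorphism C w"
  unfolding epimorphism_def
proof (intro conjI ballI impI)
  fix A u v assume A: "A \<in> Ob C" "u \<in> Mor C (Cod C w) A" "v \<in> Mor C (Cod C w) A" "w \<cdot> u = w \<cdot> v"
  then have "u \<boxplus> \<boxminus> v = Zero C (Dom C v) (Cod C v)"
    using assms(1) assms(2)[of "u \<boxplus> \<boxminus> v"] by (simp add: Mor_def)
  then show "u = v" using A Sub_eq_Zero by (simp add: Mor_def)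
qed fact

end

section \<open>Weak kernels and weak cokernels in n-exact sequences\<close>

text \<open>The entry of \<open>hs\<close> with the smaller index is the later map, so \<open>hs ! Suc i\<close> is followed by \<open>hs ! i\<close>.\<close>

lemma exact_seq_nth:
  assumes "exact_seq (Gs, hs)" "Suc i < length hs"
  shows "kernel (Gs ! Suc i) (Gs ! i) (hs ! i) = (hs ! Suc i) ` carrier (Gs ! Suc (Suc i))"
proof -
  have "\<forall>i. Suc i < length (snd t) \<longrightarrow>
      kernel (fst t ! Suc i) (fst t ! i) (snd t ! i) = (snd t ! Suc i) ` carrier (fst t ! Suc (Suc i))"
    if "exact_seq t" for t
    using that
  proof induction
    case (extension G K l g q H h)
    then show ?case by (auto simp: nth_Cons split: nat.split)
  qed simp
  from this[OF assms(1)] show ?thesis using assms(2) by simp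
qed

text \<open>A weak kernel \<open>a\<close> of \<open>b\<close>, and below a weak cokernel \<open>b\<close> of \<open>a\<close>, as factorisation properties. The
  second agrees with \<open>weak_cokernel\<close>, but it yields factorisations without detour through groups.\<close>

definition weak_ker :: "('o, 'm, 'x) additive_str_scheme \<Rightarrow> 'm \<Rightarrow> 'm \<Rightarrow> bool"
  where "weak_ker C a b \<longleftrightarrow> a \<in> Ar C \<and> b \<in> Ar C \<and> Cod C a = Dom C b \<and>
    a \<cdot>\<^bsub>C\<^esub> b = Zero C (Dom C a) (Cod C b) \<and>
    (\<forall>x \<in> Ar C. Cod C x = Dom C b \<longrightarrow> x \<cdot>\<^bsub>C\<^esub> b = Zero C (Dom C x) (Cod C b) \<longrightarrow>
       (\<exists>z \<in> Ar C. Dom C z = Dom C x \<and> Cod C z = Dom C a \<and> z \<cdot>\<^bsub>C\<^esub> a = x))"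

definition weak_coker :: "('o, 'm, 'x) additive_str_scheme \<Rightarrow> 'm \<Rightarrow> 'm \<Rightarrow> bool"
  where "weak_coker C a b \<longleftrightarrow> a \<in> Ar C \<and> b \<in> Ar C \<and> Cod C a = Dom C b \<and>
    a \<cdot>\<^bsub>C\<^esub> b = Zero C (Dom C a) (Cod C b) \<and>
    (\<forall>x \<in> Ar C. Dom C x = Cod C a \<longrightarrow> a \<cdot>\<^bsub>C\<^esub> x = Zero C (Dom C a) (Cod C x) \<longrightarrow>
       (\<exists>z \<in> Ar C. Dom C z = Cod C b \<and> Cod C z = Cod C x \<and> b \<cdot>\<^bsub>C\<^esub> z = x))"

context additive_category
begin

lemma weak_ker_D:
  assumes "weak_ker C a b"
  shows "a \<in> Ar C" "b \<in> Ar C" "Cod C a = Dom C b" "a \<cdot> b = Zero C (Dom C a) (Cod C b)"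
  using assms by (auto simp: weak_ker_def)

lemma weak_ker_factor:
  assumes "weak_ker C a b" "x \<in> Ar C" "Cod C x = Dom C b" "x \<cdot> b = Zero C (Dom C x) (Cod C b)"
  obtains z where "z \<in> Ar C" "Dom C z = Dom C x" "Cod C z = Dom C a" "z \<cdot> a = x"
  using assms unfolding weak_ker_def by blast

lemma weak_coker_D:
  assumes "weak_coker C a b"
  shows "a \<in> Ar C" "b \<in> Ar C" "Cod C a = Dom C b" "a \<cdot> b = Zero C (Dom C a) (Cod C b)"
  using assms by (auto simp: weak_coker_def)

lemma weak_coker_factor:
  assumes "weak_coker C a b" "x \<in> Ar C" "Dom C x = Cod C a" "a \<cdot> x = Zero C (Dom C a) (Cod C x)"
  obtains z where "z \<in> Ar C" "Dom C z = Cod C b" "Cod C z = Cod C x" "b \<cdot> z = x"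
  using assms unfolding weak_coker_def by blast

lemma path_D:
  assumes "path C es" "Suc i < length es"
  shows "es ! i \<in> Ar C" "es ! Suc i \<in> Ar C" "Cod C (es ! i) = Dom C (es ! Suc i)"
  using assms by (auto simp: path_def)

lemma path_obs_nth_Suc: "i < length es \<Longrightarrow> path_obs C es ! Suc i = Cod C (es ! i)"
  by (simp add: path_obs_def)

lemma path_obs_nth:
  assumes "path C es" "i < length es"
  shows "path_obs C es ! i = Dom C (es ! i)"
  using assms by (cases i) (auto simp: path_obs_def path_def hd_conv_nth)

lemma length_path_obs [simp]: "length (path_obs C es) = Suc (length es)"
  by (simp add: path_obs_def)

text \<open>Inserting the identity of the codomain of \<open>b\<close> into the exactness hypothesis gives that \<open>a \<cdot> b\<close>
  vanishes.\<close>

lemma weak_coker_I: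
  assumes "a \<in> Ar C" "b \<in> Ar C" "Cod C a = Dom C b"
    and E: "\<And>Y. Y \<in> Ob C \<Longrightarrow>
      kernel (Mor_group C (Dom C b) Y) (Mor_group C (Dom C a) Y) (\<lambda>u. a \<cdot> u)
      = (\<lambda>u. b \<cdot> u) ` Mor C (Cod C b) Y"
  shows "weak_coker C a b"
proof -
  note ab = assms(1-3)
  have "b \<in> (\<lambda>u. b \<cdot> u) ` Mor C (Cod C b) (Cod C b)"
    using ab by (auto intro!: image_eqI[of _ _ "Id C (Cod C b)"] simp: Mor_def)
  then have "a \<cdot> b = Zero C (Dom C a) (Cod C b)"
    using E[of "Cod C b"] ab by (auto simp: kernel_def Mor_group_def)
  moreover have "\<exists>z \<in> Ar C. Dom C z = Cod C b \<and> Cod C z = Cod C x \<and> b \<cdot> z = x"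
    if x: "x \<in> Ar C" "Dom C x = Cod C a" "a \<cdot> x = Zero C (Dom C a) (Cod C x)" for x
  proof -
    have "x \<in> kernel (Mor_group C (Dom C b) (Cod C x)) (Mor_group C (Dom C a) (Cod C x)) (\<lambda>u. a \<cdot> u)"
      using x ab by (simp add: kernel_def Mor_group_def Mor_def)
    then show ?thesis using E[of "Cod C x"] x by (auto simp: Mor_def)
  qed
  ultimately show ?thesis unfolding weak_coker_def using ab by blast
qed

lemma contra_left_exact_imp_weak_coker:
  assumes "path C es" and ex: "\<And>Y. Y \<in> Ob C \<Longrightarrow> contra_left_exact C es Y"
    and i: "Suc i < length es"
  shows "weak_coker C (es ! i) (es ! Suc i)"
proof -
  let ?a = "es ! i" and ?b = "es ! Suc i"
  note ab = path_D[OF assms(1) i]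
  have E: "kernel (Mor_group C (Dom C ?b) Y) (Mor_group C (Dom C ?a) Y) (\<lambda>u. ?a \<cdot> u)
      = (\<lambda>u. ?b \<cdot> u) ` Mor C (Cod C ?b) Y" if "Y \<in> Ob C" for Y
    using exact_seq_nth[OF ex[OF that, unfolded contra_left_exact_def], of i] i assms(1)
    by (simp add: nth_append path_obs_nth path_obs_nth_Suc Mor_group_def)
  show ?thesis using weak_coker_I[OF ab E] .
qed

lemma contra_left_exact_imp_epimorphism:
  assumes "path C es" and ex: "\<And>Y. Y \<in> Ob C \<Longrightarrow> contra_left_exact C es Y"
    and i: "length es = Suc m"
  shows "epimorphism C (es ! m)"
proof -
  let ?a = "es ! m"
  have a: "?a \<in> Ar C" using assms by (auto simp: path_def)
  have E: "kernel (Mor_group C (Cod C ?a) Y) (Mor_group C (Dom C ?a) Y) (\<lambda>u. ?a \<cdot> u)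
      = {Zero C (Cod C ?a) Y}" if "Y \<in> Ob C" for Y
  proof -
    have "last es = ?a" using i by (cases "es = []") (auto simp: last_conv_nth)
    then show ?thesis
      using exact_seq_nth[OF ex[OF that, unfolded contra_left_exact_def], of m] i assms(1)
      by (simp add: nth_append path_obs_nth path_obs_nth_Suc Mor_group_def singleton_group_def)
  qed
  show ?thesis
  proof (rule epimorphism_I)
    fix x assume x: "x \<in> Ar C" "Dom C x = Cod C ?a" "?a \<cdot> x = Zero C (Dom C ?a) (Cod C x)"
    then have "x \<in> kernel (Mor_group C (Cod C ?a) (Cod C x)) (Mor_group C (Dom C ?a) (Cod C x)) (\<lambda>u. ?a \<cdot> u)"
      using a by (simp add: kernel_def Mor_group_def Mor_def)
    then show "x = Zero C (Cod C ?a) (Cod C x)" using E[of "Cod C x"] x by simp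
  qed fact
qed

lemma co_left_exact_imp_weak_ker:
  assumes "path C es" and ex: "\<And>Y. Y \<in> Ob C \<Longrightarrow> co_left_exact C es Y"
    and i: "Suc i < length es"
  shows "weak_ker C (es ! i) (es ! Suc i)"
proof -
  let ?a = "es ! i" and ?b = "es ! Suc i"
  note ab = path_D[OF assms(1) i]
  have E: "kernel (Mor_group C Y (Cod C ?a)) (Mor_group C Y (Cod C ?b)) (\<lambda>u. u \<cdot> ?b)
      = (\<lambda>u. u \<cdot> ?a) ` Mor C Y (Dom C ?a)" if "Y \<in> Ob C" for Y
  proof -
    \<comment> \<open>the covariant sequence is listed in reverse, which turns position \<open>i\<close> into \<open>j\<close>\<close>
    define j where "j = length es - Suc (Suc i)"
    have "length es - Suc j = Suc i" "length es - Suc (Suc j) = i" "Suc j < length es"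
      "length es - j = Suc (Suc i)"
      using i by (auto simp: j_def)
    then show ?thesis
      using exact_seq_nth[OF ex[OF that, unfolded co_left_exact_def], of j] i assms(1)
      by (simp add: nth_append rev_nth path_obs_nth_Suc path_obs_nth[of es i] Mor_group_def)
  qed
  have "?a \<in> (\<lambda>u. u \<cdot> ?a) ` Mor C (Dom C ?a) (Dom C ?a)"
    using ab by (auto intro!: image_eqI[of _ _ "Id C (Dom C ?a)"] simp: Mor_def)
  then have "?a \<cdot> ?b = Zero C (Dom C ?a) (Cod C ?b)"
    using E[of "Dom C ?a"] ab by (auto simp: kernel_def Mor_group_def)
  moreover have "\<exists>z \<in> Ar C. Dom C z = Dom C x \<and> Cod C z = Dom C ?a \<and> z \<cdot> ?a = x"
    if x: "x \<in> Ar C" "Cod C x = Dom C ?b" "x \<cdot> ?b = Zero C (Dom C x) (Cod C ?b)" for x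
  proof -
    have "x \<in> kernel (Mor_group C (Dom C x) (Cod C ?a)) (Mor_group C (Dom C x) (Cod C ?b)) (\<lambda>u. u \<cdot> ?b)"
      using x ab by (simp add: kernel_def Mor_group_def Mor_def)
    then show ?thesis using E[of "Dom C x"] x by (auto simp: Mor_def)
  qed
  ultimately show ?thesis unfolding weak_ker_def using ab by blast
qed

lemma co_left_exact_imp_monomorphism:
  assumes "path C es" and ex: "\<And>Y. Y \<in> Ob C \<Longrightarrow> co_left_exact C es Y"
  shows "monomorphism C (es ! 0)"
proof -
  let ?a = "es ! 0"
  have ne: "es \<noteq> []" using assms(1) by (simp add: path_def)
  have a: "?a \<in> Ar C" using assms ne by (auto simp: path_def)
  have E: "kernel (Mor_group C Y (Dom C ?a)) (Mor_group C Y (Cod C ?a)) (\<lambda>u. u \<cdot> ?a)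
      = {Zero C Y (Dom C ?a)}" if "Y \<in> Ob C" for Y
  proof -
    obtain m where m: "length es = Suc m" using ne by (cases es) auto
    then show ?thesis
      using exact_seq_nth[OF ex[OF that, unfolded co_left_exact_def], of m] ne assms(1)
      by (simp add: nth_append rev_nth path_obs_nth_Suc path_obs_nth hd_conv_nth Mor_group_def
          singleton_group_def)
  qed
  show ?thesis
  proof (rule monomorphism_I)
    fix x assume x: "x \<in> Ar C" "Cod C x = Dom C ?a" "x \<cdot> ?a = Zero C (Dom C x) (Cod C ?a)"
    then have "x \<in> kernel (Mor_group C (Dom C x) (Dom C ?a)) (Mor_group C (Dom C x) (Cod C ?a)) (\<lambda>u. u \<cdot> ?a)"
      using a by (simp add: kernel_def Mor_group_def Mor_def)
    then show "x = Zero C (Dom C x) (Dom C ?a)" using E[of "Dom C x"] x by simp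
  qed fact
qed

lemma n_exact_D:
  assumes "n_exact n C es"
  shows "length es = Suc n" "monomorphism C (es ! 0)" "epimorphism C (es ! n)"
    "Suc i < length es \<Longrightarrow> weak_ker C (es ! i) (es ! Suc i)"
    "Suc i < length es \<Longrightarrow> weak_coker C (es ! i) (es ! Suc i)"
proof -
  have ne: "es \<noteq> []" and len: "length es = Suc n" using assms by (auto simp: n_exact_def)
  have p: "path C es"
    and co: "\<And>Y. Y \<in> Ob C \<Longrightarrow> co_left_exact C es Y"
    and contra: "\<And>Y. Y \<in> Ob C \<Longrightarrow> contra_left_exact C es Y"
    using assms ne by (auto simp: n_exact_def n_kernel_def n_cokernel_def)
  show "length es = Suc n" by fact
  show "monomorphism C (es ! 0)" by (rule co_left_exact_imp_monomorphism[OF p co])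
  show "epimorphism C (es ! n)" by (rule contra_left_exact_imp_epimorphism[OF p contra len])
  show "weak_ker C (es ! i) (es ! Suc i)" if "Suc i < length es"
    by (rule co_left_exact_imp_weak_ker[OF p co that])
  show "weak_coker C (es ! i) (es ! Suc i)" if "Suc i < length es"
    by (rule contra_left_exact_imp_weak_coker[OF p contra that])
qed

lemma weak_cokernel_imp_weak_coker:
  assumes "weak_cokernel C f g"
  shows "weak_coker C f g"
proof -
  have fg: "f \<in> Ar C" "g \<in> Ar C" "Cod C f = Dom C g" using assms by (auto simp: weak_cokernel_def)
  show ?thesis
    using assms by (intro weak_coker_I[OF fg]) (auto simp: weak_cokernel_def Mor_group_def)
qed

end

section \<open>Contravariant exactness up to monomorphisms\<close>

context additive_category
begin

text \<open>The last four equations are the matrix identities with a further factor on the right, as needed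
  for right-normalised composites.\<close>

lemma biproduct_D:
  assumes "biproduct C A B S i j p q" "A \<in> Ob C" "B \<in> Ob C"
  shows "S \<in> Ob C" "i \<in> Ar C" "j \<in> Ar C" "p \<in> Ar C" "q \<in> Ar C"
    "Dom C i = A" "Cod C i = S" "Dom C j = B" "Cod C j = S"
    "Dom C p = S" "Cod C p = A" "Dom C q = S" "Cod C q = B"
    "i \<cdot> p = Id C A" "j \<cdot> q = Id C B" "i \<cdot> q = Zero C A B" "j \<cdot> p = Zero C B A"
    "\<And>x. x \<in> Ar C \<Longrightarrow> Dom C x = A \<Longrightarrow> i \<cdot> (p \<cdot> x) = x"
    "\<And>x. x \<in> Ar C \<Longrightarrow> Dom C x = B \<Longrightarrow> j \<cdot> (q \<cdot> x) = x"
    "\<And>x. x \<in> Ar C \<Longrightarrow> Dom C x = B \<Longrightarrow> i \<cdot> (q \<cdot> x) = Zero C A (Cod C x)"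
    "\<And>x. x \<in> Ar C \<Longrightarrow> Dom C x = A \<Longrightarrow> j \<cdot> (p \<cdot> x) = Zero C B (Cod C x)"
proof -
  show *: "S \<in> Ob C" "i \<in> Ar C" "j \<in> Ar C" "p \<in> Ar C" "q \<in> Ar C"
    "Dom C i = A" "Cod C i = S" "Dom C j = B" "Cod C j = S"
    "Dom C p = S" "Cod C p = A" "Dom C q = S" "Cod C q = B"
    "i \<cdot> p = Id C A" "j \<cdot> q = Id C B" "i \<cdot> q = Zero C A B" "j \<cdot> p = Zero C B A"
    using assms by (auto simp: biproduct_def Mor_def)
  show "i \<cdot> (p \<cdot> x) = x" if "x \<in> Ar C" "Dom C x = A" for x
    using Comp_reassoc[of i p "Id C A" x] that * by simp
  show "j \<cdot> (q \<cdot> x) = x" if "x \<in> Ar C" "Dom C x = B" for x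
    using Comp_reassoc[of j q "Id C B" x] that * by simp
  show "i \<cdot> (q \<cdot> x) = Zero C A (Cod C x)" if "x \<in> Ar C" "Dom C x = B" for x
    using Comp_reassoc[of i q "Zero C A B" x] that * assms by simp
  show "j \<cdot> (p \<cdot> x) = Zero C B (Cod C x)" if "x \<in> Ar C" "Dom C x = A" for x
    using Comp_reassoc[of j p "Zero C B A" x] that * assms by simp
qed

lemma biproduct_split:
  assumes "biproduct C A B S i j p q" "A \<in> Ob C" "B \<in> Ob C" "x \<in> Ar C" "Cod C x = S"
  shows "x \<cdot> (p \<cdot> i) \<boxplus> x \<cdot> (q \<cdot> j) = x"
proof -
  note [simp] = biproduct_D[OF assms(1-3)]
  have "p \<cdot> i \<boxplus> q \<cdot> j = Id C S" using assms(1) by (simp add: biproduct_def)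
  then have "x \<cdot> (p \<cdot> i \<boxplus> q \<cdot> j) = x" using assms by simp
  then show ?thesis using assms by simp
qed

text \<open>A morphism killed by a weak kernel of \<open>b\<close> is killed by everything that \<open>b\<close> kills: whether the
  former holds does not depend on the weak kernel.\<close>

lemma weak_ker_Zero:
  assumes "weak_ker C a b" "x \<in> Ar C" "Dom C x = Dom C b" "a \<cdot> x = Zero C (Dom C a) (Cod C x)"
    and "y \<in> Ar C" "Cod C y = Dom C b" "y \<cdot> b = Zero C (Dom C y) (Cod C b)"
  shows "y \<cdot> x = Zero C (Dom C y) (Cod C x)"
proof -
  obtain z where z: "z \<in> Ar C" "Dom C z = Dom C y" "Cod C z = Dom C a" "z \<cdot> a = y"
    using weak_ker_factor[OF assms(1,5-7)] .
  note ab = weak_ker_D[OF assms(1)]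
  have "y \<cdot> x = z \<cdot> (a \<cdot> x)" using z ab assms by (metis Comp_assoc_Ar)
  then show ?thesis using z ab assms by simp
qed

text \<open>Extension of \<open>u\<close> along \<open>a\<close> after enlarging its codomain by a monomorphism. The enlargement is
  harmless where only the vanishing of \<open>u\<close> matters, and it makes available the last place of an
  \<open>n\<close>-exact sequence, where \<open>u\<close> itself need not extend.\<close>

definition extends_up_to_mono :: "'b \<Rightarrow> 'b \<Rightarrow> bool"
  where "extends_up_to_mono a u \<longleftrightarrow> (\<exists>w v. monomorphism C w \<and> v \<in> Ar C \<and>
    Dom C w = Cod C u \<and> Dom C v = Cod C a \<and> Cod C v = Cod C w \<and> u \<cdot> w = a \<cdot> v)"

text \<open>Exactness, up to monomorphisms, of the contravariant sequence given by \<open>a\<close>, a weak kernel of \<open>a\<close>,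
  a weak kernel of that one, and so on: \<open>exact_up_to_mono k a\<close> speaks of the domain of the \<open>k\<close>-th
  morphism of this chain, where \<open>a\<close> counts as number \<open>0\<close>. (In terms of functors, the \<open>Ext\<close> group in
  degree \<open>Suc k\<close> of the cokernel of \<open>?\<cdot>a\<close> is effaced by monomorphisms.) All choices of weak kernels are
  quantified over; \<open>exact_up_to_mono_transfer\<close> shows that one choice suffices.\<close>

primrec exact_up_to_mono :: "nat \<Rightarrow> 'b \<Rightarrow> bool"
  where
    "exact_up_to_mono 0 a \<longleftrightarrow> (\<forall>a' u. weak_ker C a' a \<longrightarrow> u \<in> Ar C \<longrightarrow> Dom C u = Dom C a \<longrightarrow>
       a' \<cdot> u = Zero C (Dom C a') (Cod C u) \<longrightarrow> extends_up_to_mono a u)"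
  | "exact_up_to_mono (Suc k) a \<longleftrightarrow> (\<forall>a'. weak_ker C a' a \<longrightarrow> exact_up_to_mono k a')"

lemma extends_up_to_mono_Comp:
  assumes "monomorphism C w" "u \<in> Ar C" "a \<in> Ar C" "Dom C u = Dom C a" "Dom C w = Cod C u"
    "extends_up_to_mono a (u \<cdot> w)"
  shows "extends_up_to_mono a u"
proof -
  have w: "w \<in> Ar C" using assms(1) by (simp add: monomorphism_def)
  obtain w' v where v: "monomorphism C w'" "v \<in> Ar C" "Dom C w' = Cod C (u \<cdot> w)" "Dom C v = Cod C a"
    "Cod C v = Cod C w'" "(u \<cdot> w) \<cdot> w' = a \<cdot> v"
    using assms(6) unfolding extends_up_to_mono_def by blast
  have w': "w' \<in> Ar C" using v(1) by (simp add: monomorphism_def)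
  show ?thesis
    unfolding extends_up_to_mono_def
    by (rule exI[of _ "w \<cdot> w'"], rule exI[of _ v])
      (use v w w' assms monomorphism_Comp[OF assms(1) v(1)] in auto)
qed

end

locale positive_n_abelian_category = n_abelian_category +
  assumes n_pos: "0 < n"
begin

lemma weak_ker_exists:
  assumes "g \<in> Ar C"
  obtains a where "weak_ker C a g"
proof -
  obtain ds where ds: "n_kernel n C g ds" using A1_kernel[OF assms] by blast
  obtain m where m: "n = Suc m" using n_pos by (cases n) auto
  have "weak_ker C ((ds @ [g]) ! m) ((ds @ [g]) ! Suc m)"
    using ds m by (intro co_left_exact_imp_weak_ker) (auto simp: n_kernel_def)
  then show ?thesis using that ds m by (simp add: n_kernel_def nth_append)
qed

text \<open>This is where \<open>A2\<close> enters.\<close>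

lemma monomorphism_is_weak_ker:
  assumes "monomorphism C f"
  obtains g where "weak_ker C f g"
proof -
  have "f \<in> Ar C" using assms by (simp add: monomorphism_def)
  then obtain ds where ds: "n_cokernel n C f ds" using A1_cokernel by blast
  note E = n_exact_D[OF A2[OF assms ds]]
  have "weak_ker C f (ds ! 0)" using E(4)[of 0] E(1) n_pos by (cases ds) auto
  then show ?thesis using that by blast
qed

text \<open>The weak pushout \<open>c\<close> of \<open>f\<close> and \<open>u\<close> is the weak cokernel of \<open>h = (f, -u)\<close>. With \<open>f\<close> also \<open>h\<close> is a
  monomorphism, hence a weak kernel of \<open>c\<close>. If \<open>x\<close> is killed by the new leg \<open>j \<cdot> c\<close>, then \<open>(0, x)\<close>
  factors through \<open>h\<close> by some \<open>z\<close> with \<open>z \<cdot> f = 0\<close>; so \<open>z\<close> and \<open>x\<close> vanish, and this leg is a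
  monomorphism along which \<open>u\<close> becomes divisible by \<open>f\<close>.\<close>

lemma monomorphism_pushout:
  assumes f: "monomorphism C f" and u: "u \<in> Ar C" "Dom C u = Dom C f"
  shows "extends_up_to_mono f u"
proof -
  have fA: "f \<in> Ar C" using f by (simp add: monomorphism_def)
  obtain S i j p q where bp: "biproduct C (Cod C f) (Cod C u) S i j p q"
    using ex_biproduct[of "Cod C f" "Cod C u"] u fA by auto
  note B [simp] = biproduct_D[OF bp Cod_Ob[OF fA] Cod_Ob[OF u(1)]]
  define h where "h = f \<cdot> i \<boxplus> \<boxminus> (u \<cdot> j)"
  have h [simp]: "h \<in> Ar C" "Dom C h = Dom C f" "Cod C h = S" unfolding h_def using fA u by auto
  have hp: "h \<cdot> p = f" unfolding h_def using fA u by simp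
  have "monomorphism C h"
  proof (rule monomorphism_I)
    fix x assume x: "x \<in> Ar C" "Cod C x = Dom C h" "x \<cdot> h = Zero C (Dom C x) (Cod C h)"
    have "x \<cdot> f = (x \<cdot> h) \<cdot> p" using x(1,2) hp by simp
    then have "x \<cdot> f = Zero C (Dom C x) (Cod C f)" unfolding x(3) using x by simp
    then show "x = Zero C (Dom C x) (Dom C h)"
      using monomorphism_cancel_Zero[OF f, of x] x by simp
  qed simp
  then obtain c where c: "weak_ker C h c" using monomorphism_is_weak_ker by blast
  note hc = weak_ker_D[OF c]
  have cA [simp]: "c \<in> Ar C" "Dom C c = S" using hc by auto
  have mono: "monomorphism C (j \<cdot> c)"
  proof (rule monomorphism_I)
    fix x assume x: "x \<in> Ar C" "Cod C x = Dom C (j \<cdot> c)"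
      "x \<cdot> (j \<cdot> c) = Zero C (Dom C x) (Cod C (j \<cdot> c))"
    obtain z where z: "z \<in> Ar C" "Dom C z = Dom C x" "Cod C z = Dom C h" "z \<cdot> h = x \<cdot> j"
      using weak_ker_factor[OF c, of "x \<cdot> j"] x by auto
    have "z \<cdot> f = (z \<cdot> h) \<cdot> p" using z(1-3) hp by simp
    also have "\<dots> = Zero C (Dom C z) (Cod C f)" unfolding z(4) using x z u fA by simp
    finally have z0: "z = Zero C (Dom C z) (Cod C z)"
      using monomorphism_cancel_Zero[OF f, of z] z by simp
    have "x = (x \<cdot> j) \<cdot> q" using x u by simp
    also have "\<dots> = (z \<cdot> h) \<cdot> q" using z by simp
    also have "\<dots> = Zero C (Dom C x) (Cod C u)" by (subst z0) (use x z u fA in simp)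
    finally show "x = Zero C (Dom C x) (Dom C (j \<cdot> c))" using u by simp
  qed simp
  have "f \<cdot> (i \<cdot> c) \<boxplus> \<boxminus> (u \<cdot> (j \<cdot> c)) = h \<cdot> c" unfolding h_def using fA u by simp
  also have "\<dots> = Zero C (Dom C f) (Cod C c)" using hc(4) by simp
  finally have "f \<cdot> (i \<cdot> c) = u \<cdot> (j \<cdot> c)"
    using Sub_eq_Zero[of "f \<cdot> (i \<cdot> c)" "u \<cdot> (j \<cdot> c)"] fA u by simp
  then show ?thesis
    unfolding extends_up_to_mono_def
    by (intro exI[of _ "j \<cdot> c"] exI[of _ "i \<cdot> c"]) (use mono fA u in auto)
qed

text \<open>Invariance under homotopy. The squares \<open>(r1, r0)\<close> and \<open>(s1, s0)\<close> are the beginnings of chain maps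
  between the weak kernel chains of \<open>a\<close> and \<open>b\<close>, and \<open>c\<close> is the beginning of a homotopy from the
  identity to the composite on the chain of \<open>b\<close>; both extend along weak kernels. An extension of
  \<open>r1 \<cdot> u\<close> over \<open>a\<close>, carried back by \<open>s0\<close> and corrected by \<open>c\<close>, is one of \<open>u\<close> over \<open>b\<close>.\<close>

lemma exact_up_to_mono_transfer:
  assumes "exact_up_to_mono k a" "a \<in> Ar C" "b \<in> Ar C"
    and "r1 \<in> Ar C" "Dom C r1 = Dom C a" "Cod C r1 = Dom C b"
    and "r0 \<in> Ar C" "Dom C r0 = Cod C a" "Cod C r0 = Cod C b" "r1 \<cdot> b = a \<cdot> r0"
    and "s1 \<in> Ar C" "Dom C s1 = Dom C b" "Cod C s1 = Dom C a"
    and "s0 \<in> Ar C" "Dom C s0 = Cod C b" "Cod C s0 = Cod C a" "s1 \<cdot> a = b \<cdot> s0"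
    and "c \<in> Ar C" "Dom C c = Cod C b" "Cod C c = Dom C b"
    and "s1 \<cdot> (r1 \<cdot> b) = b \<boxplus> b \<cdot> (c \<cdot> b)"
  shows "exact_up_to_mono k b"
  using assms
proof (induction k arbitrary: a b r1 r0 s1 s0 c)
  case 0
  note [simp] = 0(2-9,11-16,18-20)
  note eqs = 0(10,17,21)
  show ?case
    unfolding exact_up_to_mono.simps
  proof (intro allI impI)
    fix b' u assume u: "weak_ker C b' b" "u \<in> Ar C" "Dom C u = Dom C b"
      "b' \<cdot> u = Zero C (Dom C b') (Cod C u)"
    obtain a' where a': "weak_ker C a' a" using weak_ker_exists 0(2) by blast
    note A' = weak_ker_D[OF a']
    have "a' \<cdot> (r1 \<cdot> b) = Zero C (Dom C a') (Cod C b)"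
      unfolding eqs using Comp_reassoc[OF A'(4), of r0] A' by simp
    then have "(a' \<cdot> r1) \<cdot> u = Zero C (Dom C a') (Cod C u)"
      using weak_ker_Zero[OF u(1-4), of "a' \<cdot> r1"] A' by simp
    then have "extends_up_to_mono a (r1 \<cdot> u)"
      using 0(1) a' A' u by simp
    then obtain w v where v: "monomorphism C w" "v \<in> Ar C" "Dom C w = Cod C u" "Dom C v = Cod C a"
      "Cod C v = Cod C w" "(r1 \<cdot> u) \<cdot> w = a \<cdot> v"
      unfolding extends_up_to_mono_def using u by auto
    have w [simp]: "w \<in> Ar C" using v(1) by (simp add: monomorphism_def)
    let ?h = "s1 \<cdot> r1 \<boxplus> \<boxminus> (Id C (Dom C b) \<boxplus> b \<cdot> c)"
    have "?h \<cdot> b = s1 \<cdot> (r1 \<cdot> b) \<boxplus> \<boxminus> (b \<boxplus> b \<cdot> (c \<cdot> b))"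
      by (simp del: Neg_Add)
    then have "?h \<cdot> b = Zero C (Dom C b) (Cod C b)"
      unfolding eqs(3) by (simp del: Neg_Add)
    then have "?h \<cdot> u = Zero C (Dom C b) (Cod C u)"
      using weak_ker_Zero[OF u(1-4), of ?h] by simp
    then have "s1 \<cdot> (r1 \<cdot> u) \<boxplus> \<boxminus> (u \<boxplus> b \<cdot> (c \<cdot> u)) = Zero C (Dom C b) (Cod C u)"
      using u by simp
    then have s: "s1 \<cdot> (r1 \<cdot> u) = u \<boxplus> b \<cdot> (c \<cdot> u)"
      using Sub_eq_Zero[of "s1 \<cdot> (r1 \<cdot> u)" "u \<boxplus> b \<cdot> (c \<cdot> u)"] u(2,3) by simp
    have "u \<cdot> w = (u \<boxplus> b \<cdot> (c \<cdot> u)) \<cdot> w \<boxplus> \<boxminus> (b \<cdot> (c \<cdot> (u \<cdot> w)))"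
      using u v by simp
    also have "(u \<boxplus> b \<cdot> (c \<cdot> u)) \<cdot> w = s1 \<cdot> ((r1 \<cdot> u) \<cdot> w)"
      unfolding s[symmetric] using u v by simp
    also have "\<dots> = b \<cdot> (s0 \<cdot> v)"
      unfolding v(6) using Comp_reassoc[OF eqs(2), of v] v by simp
    finally have "u \<cdot> w = b \<cdot> (s0 \<cdot> v \<boxplus> \<boxminus> (c \<cdot> (u \<cdot> w)))"
      using u v by simp
    then show "extends_up_to_mono b u"
      unfolding extends_up_to_mono_def
      by (intro exI[of _ w] exI[of _ "s0 \<cdot> v \<boxplus> \<boxminus> (c \<cdot> (u \<cdot> w))"]) (use u v in auto)
  qed
next
  case (Suc k)
  note [simp] = Suc(3-10,12-17,19-21)
  note eqs = Suc(11,18,22)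
  show ?case
    unfolding exact_up_to_mono.simps
  proof (intro allI impI)
    fix b' assume b': "weak_ker C b' b"
    note B' = weak_ker_D[OF b']
    obtain a' where a': "weak_ker C a' a" using weak_ker_exists Suc(3) by blast
    note A' = weak_ker_D[OF a']
    have "a' \<cdot> (r1 \<cdot> b) = Zero C (Dom C a') (Cod C b)"
      unfolding eqs using Comp_reassoc[OF A'(4), of r0] A' by simp
    then obtain r' where r': "r' \<in> Ar C" "Dom C r' = Dom C a'" "Cod C r' = Dom C b'" "r' \<cdot> b' = a' \<cdot> r1"
      using weak_ker_factor[OF b', of "a' \<cdot> r1"] A' by auto
    have "b' \<cdot> (s1 \<cdot> a) = Zero C (Dom C b') (Cod C a)"
      unfolding eqs using Comp_reassoc[OF B'(4), of s0] B' by simp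
    then obtain s' where s': "s' \<in> Ar C" "Dom C s' = Dom C b'" "Cod C s' = Dom C a'" "s' \<cdot> a' = b' \<cdot> s1"
      using weak_ker_factor[OF a', of "b' \<cdot> s1"] B' by auto
    let ?h = "s1 \<cdot> r1 \<boxplus> \<boxminus> (Id C (Dom C b) \<boxplus> b \<cdot> c)"
    have "?h \<cdot> b = s1 \<cdot> (r1 \<cdot> b) \<boxplus> \<boxminus> (b \<boxplus> b \<cdot> (c \<cdot> b))"
      by (simp del: Neg_Add)
    then have "?h \<cdot> b = Zero C (Dom C b) (Cod C b)"
      unfolding eqs(3) by (simp del: Neg_Add)
    then obtain c' where c': "c' \<in> Ar C" "Dom C c' = Dom C b" "Cod C c' = Dom C b'" "c' \<cdot> b' = ?h"
      using weak_ker_factor[OF b', of ?h] by auto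
    have "b' \<cdot> (c' \<cdot> b') = b' \<cdot> (s1 \<cdot> r1) \<boxplus> \<boxminus> b'"
      unfolding c'(4) using B' Comp_reassoc[OF B'(4), of c] by simp
    then have "b' \<boxplus> b' \<cdot> (c' \<cdot> b') = b' \<cdot> (s1 \<cdot> r1)"
      using B' by (simp add: Add_left_commute[of b'])
    also have "\<dots> = s' \<cdot> (r' \<cdot> b')"
      unfolding r'(4) using Comp_reassoc[OF s'(4), of r1] s' A' B' by simp
    finally have "s' \<cdot> (r' \<cdot> b') = b' \<boxplus> b' \<cdot> (c' \<cdot> b')" by simp
    then show "exact_up_to_mono k b'"
      using Suc.IH[of a' b' r' r1 s' s1 c'] Suc(2) a' A' B' r' s' c' by simp
  qed
qed

lemma exact_up_to_mono_weak_ker: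
  assumes "weak_ker C a' a" "exact_up_to_mono k a'"
  shows "exact_up_to_mono (Suc k) a"
  unfolding exact_up_to_mono.simps
proof (intro allI impI)
  fix b assume b: "weak_ker C b a"
  note A = weak_ker_D[OF assms(1)] and B = weak_ker_D[OF b]
  obtain r where r: "r \<in> Ar C" "Dom C r = Dom C a'" "Cod C r = Dom C b" "r \<cdot> b = a'"
    using weak_ker_factor[OF b A(1,3,4)] .
  obtain s where s: "s \<in> Ar C" "Dom C s = Dom C b" "Cod C s = Dom C a'" "s \<cdot> a' = b"
    using weak_ker_factor[OF assms(1) B(1,3,4)] .
  show "exact_up_to_mono k b"
    by (rule exact_up_to_mono_transfer[OF assms(2), where ?r1.0 = r and ?s1.0 = s
          and ?r0.0 = "Id C (Dom C a)" and ?s0.0 = "Id C (Dom C a)" and c = "Zero C (Cod C b) (Dom C b)"])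
      (use A B r s in auto)
qed

text \<open>By \<open>A2_op\<close> an \<open>n\<close>-kernel of \<open>e\<close> completes to an \<open>n\<close>-exact sequence, so its morphisms form a chain of
  weak kernels which are followed by their weak cokernels. This settles all places but the first
  object of the sequence; there every \<open>u\<close> has to extend along a monomorphism, which a pushout does
  after a monomorphism.\<close>

lemma epimorphism_exact_up_to_mono:
  assumes "epimorphism C e" "k \<le> n"
  shows "exact_up_to_mono k e"
proof -
  have "e \<in> Ar C" using assms by (simp add: epimorphism_def)
  then obtain ds where ds: "n_kernel n C e ds" using A1_kernel by blast
  define es where "es = ds @ [e]"
  note E = n_exact_D[OF A2_op[OF assms(1) ds], folded es_def]
  have e: "es ! n = e" using ds by (simp add: es_def n_kernel_def nth_append)
  have "exact_up_to_mono 0 (es ! j)" if "j \<le> n" for j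
    unfolding exact_up_to_mono.simps
  proof (intro allI impI)
    fix a' u assume a': "weak_ker C a' (es ! j)"
      and u: "u \<in> Ar C" "Dom C u = Dom C (es ! j)" "a' \<cdot> u = Zero C (Dom C a') (Cod C u)"
    show "extends_up_to_mono (es ! j) u"
    proof (cases j)
      case 0
      then show ?thesis using monomorphism_pushout[OF E(2)] u by simp
    next
      case (Suc m)
      have ex: "weak_ker C (es ! m) (es ! j)" "weak_coker C (es ! m) (es ! j)"
        using E(4,5)[of m] E(1) Suc that by auto
      note D = weak_ker_D[OF ex(1)]
      have "(es ! m) \<cdot> u = Zero C (Dom C (es ! m)) (Cod C u)"
        using weak_ker_Zero[OF a' u] D by simp
      then obtain v where v: "v \<in> Ar C" "Dom C v = Cod C (es ! j)" "Cod C v = Cod C u" "es ! j \<cdot> v = u"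
        using weak_coker_factor[OF ex(2), of u] u D by auto
      then show ?thesis
        unfolding extends_up_to_mono_def
        by (intro exI[of _ "Id C (Cod C u)"] exI[of _ v]) (use u monomorphism_Id in auto)
    qed
  qed
  moreover have "exact_up_to_mono k (es ! (j + k))" if "j + k \<le> n" for j k
    using that
  proof (induction k)
    case (Suc k)
    then have "weak_ker C (es ! (j + k)) (es ! (j + Suc k))" using E(1,4) by simp
    then show ?case using exact_up_to_mono_weak_ker Suc by simp
  qed (use calculation in simp)
  from this[of "n - k" k] show ?thesis using assms e by simp
qed

end

section \<open>Mapping cones\<close>

context additive_category
begin

text \<open>The hypothesis on \<open>F\<close> says that \<open>F\<close> kills the same morphisms \<open>(x\<^sub>1, x\<^sub>2)\<close> as the matrix
  with rows \<open>(a, t)\<close> and \<open>(0, b)\<close>; the lemma then describes a weak kernel of \<open>F\<close> by the rows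
  \<open>(a', t')\<close> and \<open>(0, b')\<close>. Only the kernel of \<open>F\<close> is prescribed, so that the result covers both the
  matrix itself and the epimorphism \<open>(d1, k2)\<close> in \<open>exact_up_to_mono_step\<close>.
  For the factorisation, \<open>x\<^sub>1 = z \<cdot> a'\<close>, and then \<open>b\<close> kills \<open>x\<^sub>2 - z \<cdot> t'\<close>.\<close>

lemma block_weak_ker:
  assumes "weak_ker C a' a" "weak_ker C b' b"
    and "t \<in> Ar C" "Dom C t = Dom C a" "Cod C t = Cod C b"
    and "t' \<in> Ar C" "Dom C t' = Dom C a'" "Cod C t' = Dom C b"
    and "a' \<cdot> t \<boxplus> t' \<cdot> b = Zero C (Dom C a') (Cod C b)"
    and bp': "biproduct C (Dom C a') (Dom C b') S' i' j' p' q'"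
    and bp: "biproduct C (Dom C a) (Dom C b) S i j p q"
    and F: "F \<in> Ar C" "Dom C F = S"
    and F0: "\<And>x. x \<in> Ar C \<Longrightarrow> Cod C x = S \<Longrightarrow> x \<cdot> F = Zero C (Dom C x) (Cod C F) \<longleftrightarrow>
      x \<cdot> (p \<cdot> a) = Zero C (Dom C x) (Cod C a) \<and>
      x \<cdot> (p \<cdot> t) \<boxplus> x \<cdot> (q \<cdot> b) = Zero C (Dom C x) (Cod C b)"
  shows "weak_ker C (p' \<cdot> (a' \<cdot> i) \<boxplus> (p' \<cdot> (t' \<cdot> j) \<boxplus> q' \<cdot> (b' \<cdot> j))) F"
    (is "weak_ker C ?D F")
proof -
  note [simp] = weak_ker_D(1-3)[OF assms(1)] weak_ker_D(1-3)[OF assms(2)] assms(3-8) F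
  note a'a = weak_ker_D(4)[OF assms(1)] and b'b = weak_ker_D(4)[OF assms(2)]
  note B [simp] = biproduct_D[OF bp] and B' [simp] = biproduct_D[OF bp']
  have "?D \<cdot> (p \<cdot> a) = Zero C S' (Cod C a)"
    by (simp add: a'a)
  moreover have "?D \<cdot> (p \<cdot> t) \<boxplus> ?D \<cdot> (q \<cdot> b) = p' \<cdot> (a' \<cdot> t \<boxplus> t' \<cdot> b)"
    by (simp add: b'b)
  ultimately have "?D \<cdot> F = Zero C (Dom C ?D) (Cod C F)"
    by (subst F0) (simp_all add: assms(9))
  moreover have "\<exists>z \<in> Ar C. Dom C z = Dom C x \<and> Cod C z = S' \<and> z \<cdot> ?D = x"
    if x: "x \<in> Ar C" "Cod C x = S" "x \<cdot> F = Zero C (Dom C x) (Cod C F)" for x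
  proof -
    note x0 = iffD1[OF F0[OF x(1,2)] x(3)]
    obtain z where z: "z \<in> Ar C" "Dom C z = Dom C x" "Cod C z = Dom C a'" "z \<cdot> a' = x \<cdot> p"
      using weak_ker_factor[OF assms(1), of "x \<cdot> p"] x(1,2) x0 by auto
    let ?y = "x \<cdot> q \<boxplus> \<boxminus> (z \<cdot> t')"
    have "\<boxminus> (z \<cdot> (t' \<cdot> b)) = z \<cdot> (a' \<cdot> t)"
    proof -
      have "z \<cdot> (a' \<cdot> t \<boxplus> t' \<cdot> b) = Zero C (Dom C x) (Cod C b)"
        unfolding assms(9) using z by simp
      then have "z \<cdot> (t' \<cdot> b) \<boxplus> z \<cdot> (a' \<cdot> t) = Zero C (Dom C x) (Cod C b)"
        using z by (simp add: Add_commute)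
      then show ?thesis
        using Neg_unique[of "z \<cdot> (t' \<cdot> b)" "z \<cdot> (a' \<cdot> t)"] z(1-3) by simp
    qed
    also have "\<dots> = x \<cdot> (p \<cdot> t)"
      using Comp_reassoc[OF z(4), of t] z x(1,2) by simp
    finally have "?y \<cdot> b = x \<cdot> (p \<cdot> t) \<boxplus> x \<cdot> (q \<cdot> b)"
      using z x(1,2) by (simp add: Add_commute)
    then have "?y \<cdot> b = Zero C (Dom C ?y) (Cod C b)" using x0 z x(1,2) by simp
    then obtain y where y: "y \<in> Ar C" "Dom C y = Dom C x" "Cod C y = Dom C b'" "y \<cdot> b' = ?y"
      using weak_ker_factor[OF assms(2), of ?y] x(1,2) z by auto
    let ?z = "z \<cdot> i' \<boxplus> y \<cdot> j'"
    have "?z \<cdot> ?D = (z \<cdot> a') \<cdot> i \<boxplus> (z \<cdot> (t' \<cdot> j) \<boxplus> (y \<cdot> b') \<cdot> j)"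
      using z(1-3) y(1-3) by simp
    also have "\<dots> = x \<cdot> (p \<cdot> i) \<boxplus> x \<cdot> (q \<cdot> j)"
      unfolding z(4) y(4) using z(1-3) x(1,2)
      by (simp add: Add_left_commute[of "z \<cdot> (t' \<cdot> j)"])
    also have "\<dots> = x" using biproduct_split[OF bp _ _ x(1,2)] by simp
    finally show ?thesis using z y by (intro bexI[of _ ?z]) auto
  qed
  ultimately show ?thesis unfolding weak_ker_def by simp
qed

end

context positive_n_abelian_category
begin

text \<open>The triangular matrices are the differentials of a mapping cone, with the chain of \<open>a\<close> as quotient
  and the chain of \<open>b0\<close>, shifted by one place, as subobject. At the first place, the morphism \<open>(u, 0)\<close>
  extends over the cone by some \<open>(v\<^sub>1, v\<^sub>2)\<close>, that is \<open>u = a \<cdot> v\<^sub>1 + t \<cdot> v\<^sub>2\<close> and \<open>b \<cdot> v\<^sub>2 = 0\<close>.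
  Exactness at \<open>b0\<close> gives \<open>v\<^sub>2 = b0 \<cdot> v'\<close>, and \<open>t \<cdot> b0 = - a \<cdot> t0\<close> moves the second term into \<open>a\<close>. All
  this holds up to monomorphisms, which compose. The other places reduce to this one by passing to
  weak kernels.\<close>

lemma block_exact_up_to_mono:
  assumes "exact_up_to_mono k (p \<cdot> (a \<cdot> i') \<boxplus> (p \<cdot> (t \<cdot> j') \<boxplus> q \<cdot> (b \<cdot> j')))"
    and "exact_up_to_mono k b0" "weak_ker C b b0"
    and "a \<in> Ar C"
    and "t \<in> Ar C" "Dom C t = Dom C a" "Cod C t = Cod C b"
    and "t0 \<in> Ar C" "Dom C t0 = Cod C a" "Cod C t0 = Cod C b0"
    and "a \<cdot> t0 \<boxplus> t \<cdot> b0 = Zero C (Dom C a) (Cod C b0)"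
    and "biproduct C (Dom C a) (Dom C b) S i j p q"
    and "biproduct C (Cod C a) (Cod C b) S' i' j' p' q'"
  shows "exact_up_to_mono k a"
  using assms
proof (induction k arbitrary: a b b0 t t0 S i j p q S' i' j' p' q')
  case 0
  note [simp] = 0(4-10) weak_ker_D(1-3)[OF 0(3)]
  note B [simp] = biproduct_D[OF 0(12)] and B' [simp] = biproduct_D[OF 0(13)]
  let ?D = "p \<cdot> (a \<cdot> i') \<boxplus> (p \<cdot> (t \<cdot> j') \<boxplus> q \<cdot> (b \<cdot> j'))"
  show ?case
    unfolding exact_up_to_mono.simps
  proof (intro allI impI)
    fix a' u assume u: "weak_ker C a' a" "u \<in> Ar C" "Dom C u = Dom C a"
      "a' \<cdot> u = Zero C (Dom C a') (Cod C u)"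
    have DA: "?D \<in> Ar C" "Dom C ?D = S" "Cod C ?D = S'" by simp_all
    obtain D' where D': "weak_ker C D' ?D" using weak_ker_exists DA(1) by blast
    note DD = weak_ker_D[OF D']
    have [simp]: "D' \<in> Ar C" "Cod C D' = S" using DD by auto
    have "D' \<cdot> (p \<cdot> a) = (D' \<cdot> ?D) \<cdot> p'" by simp
    also have "\<dots> = Zero C (Dom C D') (Cod C a)" unfolding DD(4) by simp
    finally have "(D' \<cdot> p) \<cdot> u = Zero C (Dom C D') (Cod C u)"
      using weak_ker_Zero[OF u, of "D' \<cdot> p"] by simp
    then have "extends_up_to_mono ?D (p \<cdot> u)"
      using 0(1) D' u unfolding exact_up_to_mono.simps by simp
    then obtain w v where v: "monomorphism C w" "v \<in> Ar C" "Dom C w = Cod C u" "Dom C v = S'"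
      "Cod C v = Cod C w" "(p \<cdot> u) \<cdot> w = ?D \<cdot> v"
      unfolding extends_up_to_mono_def using u by auto
    have w [simp]: "w \<in> Ar C" using v(1) by (simp add: monomorphism_def)
    have "u \<cdot> w = i \<cdot> ((p \<cdot> u) \<cdot> w)" using u v(2-5) by simp
    also have "\<dots> = a \<cdot> (i' \<cdot> v) \<boxplus> t \<cdot> (j' \<cdot> v)" unfolding v(6) using v(2-5) by simp
    finally have uw: "u \<cdot> w = a \<cdot> (i' \<cdot> v) \<boxplus> t \<cdot> (j' \<cdot> v)" .
    have "b \<cdot> (j' \<cdot> v) = j \<cdot> (?D \<cdot> v)" using v(2-5) by simp
    also have "\<dots> = Zero C (Dom C b) (Cod C v)" unfolding v(6)[symmetric] using u v(2-5) by simp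
    finally have "extends_up_to_mono b0 (j' \<cdot> v)"
      using 0(2,3) v(2-5) by simp
    then obtain w' v' where v': "monomorphism C w'" "v' \<in> Ar C" "Dom C w' = Cod C v" "Dom C v' = Cod C b0"
      "Cod C v' = Cod C w'" "(j' \<cdot> v) \<cdot> w' = b0 \<cdot> v'"
      unfolding extends_up_to_mono_def using v(2-5) by auto
    have w' [simp]: "w' \<in> Ar C" using v'(1) by (simp add: monomorphism_def)
    have "t \<cdot> b0 = \<boxminus> (a \<cdot> t0)"
      using Neg_unique[of "a \<cdot> t0" "t \<cdot> b0"] 0(11) by simp
    then have tb: "t \<cdot> (b0 \<cdot> v') = \<boxminus> (a \<cdot> (t0 \<cdot> v'))"
      using Comp_reassoc[of t b0 "\<boxminus> (a \<cdot> t0)" v'] v'(2-5) by simp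
    have "(u \<cdot> w) \<cdot> w' = a \<cdot> (i' \<cdot> (v \<cdot> w')) \<boxplus> t \<cdot> ((j' \<cdot> v) \<cdot> w')"
      unfolding uw using v(2-5) v'(2-5) by simp
    also have "\<dots> = a \<cdot> (i' \<cdot> (v \<cdot> w') \<boxplus> \<boxminus> (t0 \<cdot> v'))"
      unfolding v'(6) tb using v(2-5) v'(2-5) by simp
    finally have "extends_up_to_mono a (u \<cdot> w)"
      unfolding extends_up_to_mono_def
      by (intro exI[of _ w'] exI[of _ "i' \<cdot> (v \<cdot> w') \<boxplus> \<boxminus> (t0 \<cdot> v')"]) (use v(2-5) v'(1-5) u in auto)
    then show "extends_up_to_mono a u"
      using extends_up_to_mono_Comp[OF v(1) u(2)] u v(2-5) by simp
  qed
next
  case (Suc k)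
  note [simp] = Suc(5-11) weak_ker_D(1-3)[OF Suc(4)]
  note B [simp] = biproduct_D[OF Suc(13)] and B' [simp] = biproduct_D[OF Suc(14)]
  let ?D = "p \<cdot> (a \<cdot> i') \<boxplus> (p \<cdot> (t \<cdot> j') \<boxplus> q \<cdot> (b \<cdot> j'))"
  show ?case
    unfolding exact_up_to_mono.simps
  proof (intro allI impI)
    fix a' assume a': "weak_ker C a' a"
    note [simp] = weak_ker_D(1-3)[OF a'] and a'a = weak_ker_D(4)[OF a']
    obtain b' where b': "weak_ker C b' b" using weak_ker_exists[of b] by auto
    note [simp] = weak_ker_D(1-3)[OF b']
    have "t \<cdot> b0 = \<boxminus> (a \<cdot> t0)"
      using Neg_unique[of "a \<cdot> t0" "t \<cdot> b0"] Suc(12) by simp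
    then have "a' \<cdot> (t \<cdot> b0) = Zero C (Dom C a') (Cod C b0)"
      using Comp_reassoc[OF a'a, of t0] by simp
    then obtain s where s: "s \<in> Ar C" "Dom C s = Dom C a'" "Cod C s = Dom C b" "s \<cdot> b = a' \<cdot> t"
      using weak_ker_factor[OF Suc(4), of "a' \<cdot> t"] by auto
    \<comment> \<open>the sign makes consecutive matrices compose to zero, as in a mapping cone\<close>
    let ?t = "\<boxminus> s"
    have rel: "a' \<cdot> t \<boxplus> ?t \<cdot> b = Zero C (Dom C a') (Cod C b)" using s by simp
    obtain S2 i2 j2 p2 q2 where bp2: "biproduct C (Dom C a') (Dom C b') S2 i2 j2 p2 q2"
      using ex_biproduct[of "Dom C a'" "Dom C b'"] by auto
    let ?D' = "p2 \<cdot> (a' \<cdot> i) \<boxplus> (p2 \<cdot> (?t \<cdot> j) \<boxplus> q2 \<cdot> (b' \<cdot> j))"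
    have "weak_ker C ?D' ?D"
    proof (rule block_weak_ker[OF a' b' _ _ _ _ _ _ rel bp2 Suc(13)])
      fix x assume x: "x \<in> Ar C" "Cod C x = S"
      have e: "(x \<cdot> ?D) \<cdot> p' = x \<cdot> (p \<cdot> a)" "(x \<cdot> ?D) \<cdot> q' = x \<cdot> (p \<cdot> t) \<boxplus> x \<cdot> (q \<cdot> b)"
        "x \<cdot> ?D = (x \<cdot> (p \<cdot> a)) \<cdot> i' \<boxplus> (x \<cdot> (p \<cdot> t) \<boxplus> x \<cdot> (q \<cdot> b)) \<cdot> j'"
        using x by simp_all
      show "x \<cdot> ?D = Zero C (Dom C x) (Cod C ?D) \<longleftrightarrow>
        x \<cdot> (p \<cdot> a) = Zero C (Dom C x) (Cod C a) \<and>
        x \<cdot> (p \<cdot> t) \<boxplus> x \<cdot> (q \<cdot> b) = Zero C (Dom C x) (Cod C b)" (is "?l \<longleftrightarrow> ?r")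
      proof
        assume ?l
        then show ?r using e(1,2) x by simp
      next
        assume ?r
        then show ?l unfolding e(3) using x by simp
      qed
    qed (use s in auto)
    then have "exact_up_to_mono k ?D'" using Suc(2) by simp
    then show "exact_up_to_mono k a'"
      by (rule Suc.IH[OF _ _ b' _ _ _ _ _ _ _ rel bp2])
        (use Suc(3,4,13) s in auto)
  qed
qed

end

section \<open>Images and projective lifts\<close>

context positive_n_abelian_category
begin

text \<open>The morphism \<open>k\<close> plays the role of the image of \<open>d\<close>. Extend \<open>u\<close> to \<open>v\<close> along \<open>k\<close>, after a
  monomorphism \<open>w\<close>. Then \<open>d \<cdot> v = d1 \<cdot> u \<cdot> w = 0\<close>, so \<open>v\<close> factors through \<open>g\<close>, and \<open>u \<cdot> w = k \<cdot> v\<close>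
  vanishes because \<open>k \<cdot> g = 0\<close>.\<close>

lemma image_factor_Zero:
  assumes "weak_coker C d g" "exact_up_to_mono (Suc 0) g" "weak_ker C k g" "weak_ker C k' k"
    and d1: "d1 \<in> Ar C" "Dom C d1 = Dom C d" "Cod C d1 = Dom C k" "d1 \<cdot> k = d"
    and u: "u \<in> Ar C" "Dom C u = Dom C k" "d1 \<cdot> u = Zero C (Dom C d) (Cod C u)"
      "k' \<cdot> u = Zero C (Dom C k') (Cod C u)"
  shows "u = Zero C (Dom C k) (Cod C u)"
proof -
  note [simp] = weak_coker_D(1-3)[OF assms(1)] weak_ker_D(1-3)[OF assms(3)] weak_ker_D(1-3)[OF assms(4)]
    d1(1-3)
  have "extends_up_to_mono k u" using assms(2-4) u by simp
  then obtain w v where v: "monomorphism C w" "v \<in> Ar C" "Dom C w = Cod C u" "Dom C v = Cod C k"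
    "Cod C v = Cod C w" "u \<cdot> w = k \<cdot> v"
    unfolding extends_up_to_mono_def by blast
  have w [simp]: "w \<in> Ar C" using v(1) by (simp add: monomorphism_def)
  have "d \<cdot> v = (d1 \<cdot> u) \<cdot> w"
    using Comp_reassoc[OF d1(4), of v] v u(1,2) by simp
  also have "\<dots> = Zero C (Dom C d) (Cod C v)" unfolding u(3) using v u(1) by simp
  finally obtain z where z: "z \<in> Ar C" "Dom C z = Cod C g" "Cod C z = Cod C v" "g \<cdot> z = v"
    using weak_coker_factor[OF assms(1), of v] v by auto
  have "u \<cdot> w = k \<cdot> (g \<cdot> z)" using z v by simp
  also have "\<dots> = Zero C (Dom C k) (Cod C w)"
    using Comp_reassoc[OF weak_ker_D(4)[OF assms(3)], of z] z(1-3) v by simp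
  finally show ?thesis using monomorphism_cancel_Zero[OF v(1), of u] u v(3) by simp
qed

lemma image_cover_epimorphism:
  assumes "weak_coker C d g" "exact_up_to_mono (Suc 0) g" "weak_ker C k g" "weak_ker C k' k"
    and d1: "d1 \<in> Ar C" "Dom C d1 = Dom C d" "Cod C d1 = Dom C k" "d1 \<cdot> k = d"
    and bp: "biproduct C (Dom C d) (Dom C k') S i j p q"
  shows "epimorphism C (p \<cdot> d1 \<boxplus> q \<cdot> k')"
proof (rule epimorphism_I)
  note [simp] = weak_coker_D(1-3)[OF assms(1)] weak_ker_D(1-3)[OF assms(3)] weak_ker_D(1-3)[OF assms(4)]
    d1(1-3)
  note B [simp] = biproduct_D[OF bp]
  let ?e = "p \<cdot> d1 \<boxplus> q \<cdot> k'"
  show "?e \<in> Ar C" by simp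
  fix u assume u: "u \<in> Ar C" "Dom C u = Cod C ?e" "?e \<cdot> u = Zero C (Dom C ?e) (Cod C u)"
  have "d1 \<cdot> u = i \<cdot> (?e \<cdot> u)" "k' \<cdot> u = j \<cdot> (?e \<cdot> u)" using u(1,2) by simp_all
  then have "d1 \<cdot> u = Zero C (Dom C d) (Cod C u)" "k' \<cdot> u = Zero C (Dom C k') (Cod C u)"
    unfolding u(3) using u(1,2) by simp_all
  then show "u = Zero C (Cod C ?e) (Cod C u)"
    using image_factor_Zero[OF assms(1-4) d1 u(1)] u(2) by simp
qed

text \<open>The matrix \<open>e\<close> with entries \<open>d1\<close> and \<open>k2\<close> is an epimorphism by the preceding lemma, and its
  weak kernel chain is the mapping cone built from that of \<open>d\<close> and that of \<open>g\<close>. Exactness for \<open>e\<close> and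
  for \<open>g\<close>, the latter one place further on because of the shift, gives exactness for \<open>d\<close>.\<close>

lemma exact_up_to_mono_step:
  assumes "weak_coker C d g" "exact_up_to_mono (Suc 0) g" "exact_up_to_mono (Suc (Suc m)) g"
    and epi: "\<And>e. epimorphism C e \<Longrightarrow> exact_up_to_mono (Suc m) e"
  shows "exact_up_to_mono (Suc m) d"
proof -
  note G [simp] = weak_coker_D(1-3)[OF assms(1)] and dg = weak_coker_D(4)[OF assms(1)]
  obtain k1 where k1: "weak_ker C k1 g" using weak_ker_exists G(2) by blast
  note K1 [simp] = weak_ker_D(1-3)[OF k1]
  obtain k2 where k2: "weak_ker C k2 k1" using weak_ker_exists K1(1) by blast
  note K2 [simp] = weak_ker_D(1-3)[OF k2]
  obtain k3 where k3: "weak_ker C k3 k2" using weak_ker_exists K2(1) by blast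
  note K3 [simp] = weak_ker_D(1-3)[OF k3]
  obtain k where k: "weak_ker C k d" using weak_ker_exists G(1) by blast
  note K [simp] = weak_ker_D(1-3)[OF k] and kd = weak_ker_D(4)[OF k]
  obtain d1 where d1: "d1 \<in> Ar C" "Dom C d1 = Dom C d" "Cod C d1 = Dom C k1" "d1 \<cdot> k1 = d"
    using weak_ker_factor[OF k1, of d] dg by auto
  note [simp] = d1(1-3)
  obtain S i j p q where bp: "biproduct C (Dom C d) (Dom C k2) S i j p q"
    using ex_biproduct[of "Dom C d" "Dom C k2"] by auto
  note B [simp] = biproduct_D[OF bp]
  let ?e = "p \<cdot> d1 \<boxplus> q \<cdot> k2"
  have "epimorphism C ?e" using image_cover_epimorphism[OF assms(1,2) k1 k2 d1 bp] .
  then have e: "exact_up_to_mono (Suc m) ?e" by (rule epi)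
  have "(k \<cdot> d1) \<cdot> k1 = Zero C (Dom C k) (Cod C k1)" using d1(4) kd by simp
  then obtain s where s: "s \<in> Ar C" "Dom C s = Dom C k" "Cod C s = Dom C k2" "s \<cdot> k2 = k \<cdot> d1"
    using weak_ker_factor[OF k2, of "k \<cdot> d1"] by auto
  have rel: "k \<cdot> d1 \<boxplus> \<boxminus> s \<cdot> k2 = Zero C (Dom C k) (Cod C k2)" using s by simp
  obtain S' i' j' p' q' where bp': "biproduct C (Dom C k) (Dom C k3) S' i' j' p' q'"
    using ex_biproduct[of "Dom C k" "Dom C k3"] by auto
  note B' [simp] = biproduct_D[OF bp']
  let ?D = "p' \<cdot> (k \<cdot> i) \<boxplus> (p' \<cdot> (\<boxminus> s \<cdot> j) \<boxplus> q' \<cdot> (k3 \<cdot> j))"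
  have "weak_ker C ?D ?e"
  proof (rule block_weak_ker[OF k k3 _ _ _ _ _ _ rel bp' bp])
    fix x assume x: "x \<in> Ar C" "Cod C x = S"
    have "x \<cdot> (p \<cdot> d) = Zero C (Dom C x) (Cod C d)"
      if "x \<cdot> (p \<cdot> d1) \<boxplus> x \<cdot> (q \<cdot> k2) = Zero C (Dom C x) (Cod C k2)"
    proof -
      have "(x \<cdot> (p \<cdot> d1) \<boxplus> x \<cdot> (q \<cdot> k2)) \<cdot> k1 = Zero C (Dom C x) (Cod C d)"
        unfolding that using x by simp
      then show ?thesis using x d1(4) weak_ker_D(4)[OF k2] by simp
    qed
    then show "x \<cdot> ?e = Zero C (Dom C x) (Cod C ?e) \<longleftrightarrow>
        x \<cdot> (p \<cdot> d) = Zero C (Dom C x) (Cod C d) \<and>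
        x \<cdot> (p \<cdot> d1) \<boxplus> x \<cdot> (q \<cdot> k2) = Zero C (Dom C x) (Cod C k2)"
      using x by auto
  qed (use s in auto)
  then have "exact_up_to_mono m ?D" using e by simp
  then have "exact_up_to_mono m k"
  proof (rule block_exact_up_to_mono[OF _ _ k3 _ _ _ _ _ _ _ rel bp'])
    show "exact_up_to_mono m k2" using assms(3) k1 k2 by simp
    show "biproduct C (Cod C k) (Cod C k3) S i j p q" using bp by simp
  qed (use s in auto)
  then show ?thesis using exact_up_to_mono_weak_ker[OF k] by blast
qed

text \<open>A chain of successive weak cokernels that starts with \<open>d\<close>, has \<open>m\<close> further morphisms and ends in an
  epimorphism: this is the situation of each morphism in an \<open>n\<close>-cokernel.\<close>

primrec coresolved_by :: "nat \<Rightarrow> 'b \<Rightarrow> bool"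
  where
    "coresolved_by 0 d \<longleftrightarrow> epimorphism C d"
  | "coresolved_by (Suc m) d \<longleftrightarrow> (\<exists>g. weak_coker C d g \<and> coresolved_by m g)"

text \<open>An epimorphism is exact in \<open>n\<close> places beyond place \<open>0\<close>, and each further morphism in the chain costs
  one of them.\<close>

lemma coresolved_by_exact_up_to_mono:
  "coresolved_by m d \<Longrightarrow> m + k < n \<Longrightarrow> exact_up_to_mono (Suc k) d"
proof (induction m arbitrary: d k)
  case 0
  then show ?case using epimorphism_exact_up_to_mono[of d "Suc k"] by simp
next
  case (Suc m)
  then obtain g where g: "weak_coker C d g" "coresolved_by m g" by auto
  show ?case
  proof (rule exact_up_to_mono_step[OF g(1)])
    show "exact_up_to_mono (Suc 0) g" "exact_up_to_mono (Suc (Suc k)) g"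
      using Suc.IH[OF g(2)] Suc.prems(2) by (simp_all del: exact_up_to_mono.simps)
    show "exact_up_to_mono (Suc k) e" if "epimorphism C e" for e
      using epimorphism_exact_up_to_mono[OF that] Suc.prems(2) by (simp del: exact_up_to_mono.simps)
  qed
qed

lemma n_cokernel_coresolved_by:
  assumes "n_cokernel n C f ds"
  shows "weak_coker C f (ds ! 0)" "coresolved_by (n - 1) (ds ! 0)"
proof -
  let ?es = "f # ds"
  have p: "path C ?es" and len: "length ?es = Suc n"
    and ex: "\<And>Y. Y \<in> Ob C \<Longrightarrow> contra_left_exact C ?es Y"
    using assms by (auto simp: n_cokernel_def)
  note W = contra_left_exact_imp_weak_coker[OF p ex]
  show "weak_coker C f (ds ! 0)" using W[of 0] len n_pos by (cases ds) auto
  have "coresolved_by m (?es ! (n - m))" if "m \<le> n" for m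
    using that
  proof (induction m)
    case 0
    then show ?case using contra_left_exact_imp_epimorphism[OF p ex len] by simp
  next
    case (Suc m)
    have eq: "Suc (n - Suc m) = n - m" using Suc.prems by simp
    have "weak_coker C (?es ! (n - Suc m)) (?es ! (n - m))"
      using W[of "n - Suc m"] len Suc.prems unfolding eq by simp
    then show ?case using Suc by auto
  qed
  from this[of "n - 1"] show "coresolved_by (n - 1) (ds ! 0)" using n_pos by simp
qed

text \<open>The first morphism \<open>g'\<close> of an \<open>n\<close>-cokernel of \<open>f\<close> factors through \<open>g\<close>, so it also kills \<open>h\<close>; and
  as \<open>coresolved_by (n - 1)\<close> holds for it, exactly one place is left for use in
  \<open>image_cover_epimorphism\<close>. Lift the factorisation \<open>h1\<close> of \<open>h\<close> through the weak kernel \<open>k\<close> along the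
  epimorphism found there: the component in the domain of \<open>k'\<close> dies in \<open>k\<close>, and the other one is the
  required lift.\<close>

lemma projective_lifts_weak_coker:
  assumes P: "projective_object C P" and fg: "weak_coker C f g"
    and h: "h \<in> Ar C" "Dom C h = P" "Cod C h = Cod C f" "h \<cdot> g = Zero C P (Cod C g)"
  obtains x where "x \<in> Ar C" "Dom C x = P" "Cod C x = Dom C f" "x \<cdot> f = h"
proof -
  note F = weak_coker_D(1-3)[OF fg]
  note [simp] = F h(1-3)
  obtain ds where ds: "n_cokernel n C f ds" using A1_cokernel F(1) by blast
  define g' where "g' = ds ! 0"
  have fg': "weak_coker C f g'" and ex: "exact_up_to_mono (Suc 0) g'"
    using n_cokernel_coresolved_by[OF ds] n_pos coresolved_by_exact_up_to_mono[of "n - 1" g' 0]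
    by (simp_all add: g'_def del: exact_up_to_mono.simps)
  note F' = weak_coker_D[OF fg']
  have [simp]: "Dom C g = Dom C g'" using F'(3) by simp
  note [simp] = F'(1,2)
  obtain y where y: "y \<in> Ar C" "Dom C y = Cod C g" "Cod C y = Cod C g'" "g \<cdot> y = g'"
    using weak_coker_factor[OF fg F'(2)] F' by metis
  have P_Ob [simp]: "P \<in> Ob C" using P by (simp add: projective_object_def)
  have hg': "h \<cdot> g' = Zero C (Dom C h) (Cod C g')"
    using Comp_reassoc[OF h(4), of y] y by simp
  obtain k where k: "weak_ker C k g'" using weak_ker_exists F'(2) by blast
  note K [simp] = weak_ker_D(1-3)[OF k]
  obtain k' where k': "weak_ker C k' k" using weak_ker_exists K(1) by blast
  note K' [simp] = weak_ker_D(1-3)[OF k']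
  obtain f1 where f1: "f1 \<in> Ar C" "Dom C f1 = Dom C f" "Cod C f1 = Dom C k" "f1 \<cdot> k = f"
    using weak_ker_factor[OF k, of f] F'(4) by auto
  obtain h1 where h1: "h1 \<in> Ar C" "Dom C h1 = P" "Cod C h1 = Dom C k" "h1 \<cdot> k = h"
    using weak_ker_factor[OF k, of h] hg' by auto
  obtain S i j p q where bp: "biproduct C (Dom C f) (Dom C k') S i j p q"
    using ex_biproduct[of "Dom C f" "Dom C k'"] by auto
  note B [simp] = biproduct_D[OF bp]
  let ?e = "p \<cdot> f1 \<boxplus> q \<cdot> k'"
  note [simp] = f1(1-3)
  have "epimorphism C ?e" using image_cover_epimorphism[OF fg' ex k k' f1 bp] .
  moreover have "?e \<in> Mor C S (Dom C k)" "h1 \<in> Mor C P (Dom C k)" using h1 by (simp_all add: Mor_def)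
  moreover have "S \<in> Ob C" "Dom C k \<in> Ob C" by simp_all
  ultimately have "h1 \<in> (\<lambda>u. u \<cdot> ?e) ` Mor C P S"
    using P unfolding projective_object_def by blast
  then obtain v where v: "v \<in> Ar C" "Dom C v = P" "Cod C v = S" "h1 = v \<cdot> ?e"
    by (auto simp: Mor_def)
  have "h = (v \<cdot> ?e) \<cdot> k" using h1(4) v(4) by simp
  also have "\<dots> = (v \<cdot> p) \<cdot> f" using v(1-3) f1(4) weak_ker_D(4)[OF k'] by simp
  finally show ?thesis using that[of "v \<cdot> p"] v(1-3) by simp
qed

lemma postcomp_group_hom:
  assumes "A \<in> Ob C" "f \<in> Ar C"
  shows "group_hom (Mor_group C A (Dom C f)) (Mor_group C A (Cod C f)) (\<lambda>u. u \<cdot> f)"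
proof -
  interpret G: comm_group "Mor_group C A (Dom C f)" using Mor_group assms by simp
  interpret H: comm_group "Mor_group C A (Cod C f)" using Mor_group assms by simp
  show ?thesis
    by unfold_locales (use assms in \<open>auto simp: hom_def Mor_group_def Mor_def\<close>)
qed

end

theorem theorem3p12:
  fixes n :: nat and \<M> :: "('o, 'm, 'x) additive_str_scheme"
    and P L M N :: 'o and f g :: 'm
  assumes "n > 0"
    and "n_abelian_category n \<M>"
    and "projective_object \<M> P"
    and "L \<in> Ob \<M>" and "M \<in> Ob \<M>" and "N \<in> Ob \<M>"
    and "f \<in> Mor \<M> L M"
    and "g \<in> Mor \<M> M N"
    and "weak_cokernel \<M> f g"
  shows "exact_seq
    ([Mor_group \<M> P N, Mor_group \<M> P M, Mor_group \<M> P L],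
     [\<lambda>u. u \<cdot>\<^bsub>\<M>\<^esub> g, \<lambda>u. u \<cdot>\<^bsub>\<M>\<^esub> f])"
proof -
  interpret positive_n_abelian_category n \<M>
    using assms(1,2) by (simp add: positive_n_abelian_category_def positive_n_abelian_category_axioms_def)
  have P: "P \<in> Ob \<M>" using assms(3) by (simp add: projective_object_def)
  have f: "f \<in> Ar \<M>" "Dom \<M> f = L" "Cod \<M> f = M" and g: "g \<in> Ar \<M>" "Dom \<M> g = M" "Cod \<M> g = N"
    using assms(7,8) by (auto simp: Mor_def)
  have fg: "weak_coker \<M> f g" using weak_cokernel_imp_weak_coker[OF assms(9)] .
  interpret F: group_hom "Mor_group \<M> P L" "Mor_group \<M> P M" "\<lambda>u. u \<cdot>\<^bsub>\<M>\<^esub> f"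
    using postcomp_group_hom[OF P f(1)] f by simp
  interpret G: group_hom "Mor_group \<M> P M" "Mor_group \<M> P N" "\<lambda>u. u \<cdot>\<^bsub>\<M>\<^esub> g"
    using postcomp_group_hom[OF P g(1)] g by simp
  have "kernel (Mor_group \<M> P M) (Mor_group \<M> P N) (\<lambda>u. u \<cdot>\<^bsub>\<M>\<^esub> g)
      = (\<lambda>u. u \<cdot>\<^bsub>\<M>\<^esub> f) ` carrier (Mor_group \<M> P L)" (is "?K = ?I")
  proof
    show "?K \<subseteq> ?I"
    proof
      fix h assume "h \<in> ?K"
      then have "h \<in> Ar \<M>" "Dom \<M> h = P" "Cod \<M> h = Cod \<M> f" "h \<cdot>\<^bsub>\<M>\<^esub> g = Zero \<M> P (Cod \<M> g)"
        using f g by (auto simp: kernel_def Mor_group_def Mor_def)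
      from projective_lifts_weak_coker[OF assms(3) fg this]
      show "h \<in> ?I" using f by (auto simp: Mor_group_def Mor_def)
    qed
    show "?I \<subseteq> ?K"
      using f g P weak_coker_D(4)[OF fg] by (auto simp: kernel_def Mor_group_def Mor_def)
  qed
  then show ?thesis
    using F.group_hom_axioms G.is_group G.H.is_group G.homh by simp
qed

end
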